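(* Let $X$ be a first-countable, causally simple, timelike path-connected, geodesic Lorentzian pre-length space, or a metric-compatible KS-Lorentzian pre-length space with these properties. Assume that $X$ has a finite, continuous Lorentzian distance, compact causal diamonds, no bubbling boundary, and satisfies Condition B, and assume moreover that the chronological boundary of $X$ is empty. Let $S$ be a Cauchy set in $X$. If $d_J(S,\cdot)$ is continuous, then the function $\tau_S:X\to\mathbb{R}$ defined by $$\tau_S(x)=\begin{cases} d_J(S,x) & \text{if } x\in J^+(S),\\ -d_J(S,x) & \text{if } x\in J^-(S)\end{cases}$$ is continuous, has level sets $(\tau_S)^{-1}(t)=S_t$, and satisfies $$\lim_{t\searrow\inf I}(\tau_S\circ\gamma)(t)=-\infty\quad\text{and}\quad\lim_{t\nearrow\sup I}(\tau_S\circ\gamma)(t)=\infty$$ for every inextendible timelike curve $\gamma:I\to X$.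
   Context: An extended time separation function on a set $X$ is a map $\ell:X\times X\to\{-\infty\}\cup[0,\infty]$ with $\ell(x,x)\ge0$ and $\ell(x,y)+\ell(y,z)\le\ell(x,z)$ (convention $-\infty+\infty=-\infty$). Put $d=\max(0,\ell)$ (Lorentzian distance); $x\le y$ iff $\ell(x,y)\ge0$; $x\ll y$ iff $d(x,y)>0$; $J^+(x)=\{y:x\le y\}$, $J^-(x)=\{y:y\le x\}$, $I^+(x)=\{y:x\ll y\}$, $I^-(x)=\{y:y\ll x\}$, $J^\pm(A)=\bigcup_{x\in A}J^\pm(x)$. A Lorentzian pre-length space is such a pair with a topology for which all $I^\pm(x)$ are open. Causally simple: $\le$ is antisymmetric and all $J^\pm(x)$ are closed. Causal diamonds are the sets $J^+(x)\cap J^-(y)$. Boundaries: $\partial^\pm_{ca}X=\{x:J^\pm(x)=\{x\}\}$, $\partial^\pm_{ch}X=\{x:I^\pm(x)=\emptyset\}$; the chronological boundary is $\partial^+_{ch}X\cup\partial^-_{ch}X$; no bubbling boundary means $\partial^+_{ca}X=\partial^+_{ch}X=:\partial^+X$ and $\partial^-_{ca}X=\partial^-_{ch}X=:\partial^-X$. Curves are continuous maps from intervals $I\subset\mathbb{R}$; $\gamma$ is causal (timelike) if $t<s$ implies $\gamma(t)\le\gamma(s)$ ($\gamma(t)\ll\gamma(s)$). Timelike path-connected: any $x\ll y$ can be connected by a timelike curve. $L(\gamma)=\inf\sum_i d(\gamma(t_i),\gamma(t_{i+1}))$ over partitions of $[a,b]$. Geodesic: for all $x\le y$ there is a causal curve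 $\gamma$ from $x$ to $y$ with $L(\gamma)=d(x,y)$. A KS-Lorentzian pre-length space is a Lorentzian pre-length space with a metric $\rho$ inducing its topology such that $d$ is lower semicontinuous; in this setting all curves, and all notions defined via curves, are in terms of curves locally Lipschitz with respect to $\rho$. It is metric-compatible if every $x$ has a neighborhood $U$ and a $C>0$ such that every causal curve contained in $U$ has $\rho$-arclength at most $C$. A causal curve $\gamma:I\to X$ is future extendible if there exist an order-preserving homeomorphism $\varphi:I\to\hat I$ onto an interval, an interval $\tilde I\supset\hat I$ containing some $t$ with $t>s$ for all $s\in\hat I$, and a causal curve $\tilde\gamma:\tilde I\to X$ with $\tilde\gamma|_{\hat I}=\gamma\circ\varphi^{-1}$; otherwise future inextendible. Past versions are analogous; inextendible means both. A timelike curve is (future, past) inextendible if it is so as a causal curve. Condition B: for every future inextendible timelike curve $\gamma:I\to X$, if $d(\gamma(t_0),\gamma(\cdot))$ is bounded on $[t_0,\infty)\cap I$ for some $t_0\in I$, then $\sup I\in I$; and analogously for every past inextendible timelike curve. A Cauchy set is a subset of $X$ intersected exactly once by every inextendible timelike curve. $d_J(A,B)=\sup_{x\in A,y\in B}(d(x,y)+d(y,x))$ and $d_J(S,x)=d_J(x,S)=d_J(\{x\},S)$. The $t$-parallel set of a Cauchy set $S$ is $S_0=S$ and, for $t\ne0$, $S_t=\{x\in J^{\mathrm{sign}(t)}(S): d_J(x,S)=|t|\}\cup\{x\in\partial^{\mathrm{sign}(t)}X: d_J(x,S)<|t|\}$. *)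

theory Defs
  imports "HOL-Analysis.Analysis"
begin

section \<open>Time separation and causal relations\<close>

text \<open>
  In \<^typ>\<open>ereal\<close> one has \<open>\<infinity> + (-\<infinity>) = \<infinity>\<close>, whereas the reverse triangle inequality is meant with
  \<open>-\<infinity> + \<infinity> = -\<infinity>\<close>.  Under the latter convention the inequality is void as soon as one summand is
  \<open>-\<infinity>\<close>, hence the two guards below.
\<close>

definition extended_time_separation :: "('a \<Rightarrow> 'a \<Rightarrow> ereal) \<Rightarrow> bool" where
  "extended_time_separation l \<longleftrightarrow>
     (\<forall>x y. l x y = -\<infinity> \<or> 0 \<le> l x y) \<and>
     (\<forall>x. 0 \<le> l x x) \<and>
     (\<forall>x y z. l x y \<noteq> -\<infinity> \<longrightarrow> l y z \<noteq> -\<infinity> \<longrightarrow> l x y + l y z \<le> l x z)"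

definition lor_dist :: "('a \<Rightarrow> 'a \<Rightarrow> ereal) \<Rightarrow> 'a \<Rightarrow> 'a \<Rightarrow> ereal" where
  "lor_dist l x y = max 0 (l x y)"

definition causal_le :: "('a \<Rightarrow> 'a \<Rightarrow> ereal) \<Rightarrow> 'a \<Rightarrow> 'a \<Rightarrow> bool" where
  "causal_le l x y \<longleftrightarrow> 0 \<le> l x y"

definition chron_less :: "('a \<Rightarrow> 'a \<Rightarrow> ereal) \<Rightarrow> 'a \<Rightarrow> 'a \<Rightarrow> bool" where
  "chron_less l x y \<longleftrightarrow> 0 < lor_dist l x y"

definition J_plus :: "('a \<Rightarrow> 'a \<Rightarrow> ereal) \<Rightarrow> 'a \<Rightarrow> 'a set" where
  "J_plus l x = {y. causal_le l x y}"

definition J_minus :: "('a \<Rightarrow> 'a \<Rightarrow> ereal) \<Rightarrow> 'a \<Rightarrow> 'a set" where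
  "J_minus l x = {y. causal_le l y x}"

definition I_plus :: "('a \<Rightarrow> 'a \<Rightarrow> ereal) \<Rightarrow> 'a \<Rightarrow> 'a set" where
  "I_plus l x = {y. chron_less l x y}"

definition I_minus :: "('a \<Rightarrow> 'a \<Rightarrow> ereal) \<Rightarrow> 'a \<Rightarrow> 'a set" where
  "I_minus l x = {y. chron_less l y x}"

definition J_plus_set :: "('a \<Rightarrow> 'a \<Rightarrow> ereal) \<Rightarrow> 'a set \<Rightarrow> 'a set" where
  "J_plus_set l A = (\<Union>x\<in>A. J_plus l x)"

definition J_minus_set :: "('a \<Rightarrow> 'a \<Rightarrow> ereal) \<Rightarrow> 'a set \<Rightarrow> 'a set" where
  "J_minus_set l A = (\<Union>x\<in>A. J_minus l x)"

definition lorentzian_pre_length_space :: "('a::topological_space \<Rightarrow> 'a \<Rightarrow> ereal) \<Rightarrow> bool" where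
  "lorentzian_pre_length_space l \<longleftrightarrow>
     extended_time_separation l \<and> (\<forall>x. open (I_plus l x) \<and> open (I_minus l x))"

definition causally_simple :: "('a::topological_space \<Rightarrow> 'a \<Rightarrow> ereal) \<Rightarrow> bool" where
  "causally_simple l \<longleftrightarrow>
     (\<forall>x y. causal_le l x y \<longrightarrow> causal_le l y x \<longrightarrow> x = y) \<and>
     (\<forall>x. closed (J_plus l x) \<and> closed (J_minus l x))"

definition compact_causal_diamonds :: "('a::topological_space \<Rightarrow> 'a \<Rightarrow> ereal) \<Rightarrow> bool" where
  "compact_causal_diamonds l \<longleftrightarrow> (\<forall>x y. compact (J_plus l x \<inter> J_minus l y))"

definition finite_lor_dist :: "('a \<Rightarrow> 'a \<Rightarrow> ereal) \<Rightarrow> bool" where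
  "finite_lor_dist l \<longleftrightarrow> (\<forall>x y. lor_dist l x y < \<infinity>)"

definition continuous_lor_dist :: "('a::topological_space \<Rightarrow> 'a \<Rightarrow> ereal) \<Rightarrow> bool" where
  "continuous_lor_dist l \<longleftrightarrow> continuous_on UNIV (\<lambda>(x, y). lor_dist l x y)"

definition lower_semicontinuous_lor_dist :: "('a::topological_space \<Rightarrow> 'a \<Rightarrow> ereal) \<Rightarrow> bool" where
  "lower_semicontinuous_lor_dist l \<longleftrightarrow> (\<forall>c. open {(x, y). c < lor_dist l x y})"


section \<open>Boundaries\<close>

definition causal_bdry_plus :: "('a \<Rightarrow> 'a \<Rightarrow> ereal) \<Rightarrow> 'a set" where
  "causal_bdry_plus l = {x. J_plus l x = {x}}"

definition causal_bdry_minus :: "('a \<Rightarrow> 'a \<Rightarrow> ereal) \<Rightarrow> 'a set" where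
  "causal_bdry_minus l = {x. J_minus l x = {x}}"

definition chron_bdry_plus :: "('a \<Rightarrow> 'a \<Rightarrow> ereal) \<Rightarrow> 'a set" where
  "chron_bdry_plus l = {x. I_plus l x = {}}"

definition chron_bdry_minus :: "('a \<Rightarrow> 'a \<Rightarrow> ereal) \<Rightarrow> 'a set" where
  "chron_bdry_minus l = {x. I_minus l x = {}}"

definition chron_bdry :: "('a \<Rightarrow> 'a \<Rightarrow> ereal) \<Rightarrow> 'a set" where
  "chron_bdry l = chron_bdry_plus l \<union> chron_bdry_minus l"

definition no_bubbling_bdry :: "('a \<Rightarrow> 'a \<Rightarrow> ereal) \<Rightarrow> bool" where
  "no_bubbling_bdry l \<longleftrightarrow>
     causal_bdry_plus l = chron_bdry_plus l \<and> causal_bdry_minus l = chron_bdry_minus l"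


section \<open>Curves\<close>

text \<open>
  A curve is a function \<open>\<gamma>\<close> on the reals together with its parameter interval \<open>I\<close>; only the values
  of \<open>\<gamma>\<close> on \<open>I\<close> matter.  All notions that depend on curves take as a parameter \<open>cv\<close> the class of
  admissible curves: \<open>continuous_curve\<close> for a Lorentzian pre-length space with a mere topology,
  \<open>lipschitz_curve \<rho>\<close> for a KS-Lorentzian pre-length space with metric \<open>\<rho>\<close>.
\<close>

type_synonym 'a curve_class = "real set \<Rightarrow> (real \<Rightarrow> 'a) \<Rightarrow> bool"

definition continuous_curve :: "'a::topological_space curve_class" where
  "continuous_curve I \<gamma> \<longleftrightarrow> is_interval I \<and> continuous_on I \<gamma>"

definition lipschitz_curve :: "'a::topological_space metric \<Rightarrow> 'a curve_class" where
  "lipschitz_curve \<rho> I \<gamma> \<longleftrightarrow> continuous_curve I \<gamma> \<and>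
     (\<forall>t\<in>I. \<exists>e>0. \<exists>K. \<forall>r\<in>I \<inter> ball t e. \<forall>s\<in>I \<inter> ball t e.
        mdist \<rho> (\<gamma> r) (\<gamma> s) \<le> K * \<bar>r - s\<bar>)"

definition causal_curve ::
    "'a curve_class \<Rightarrow> ('a \<Rightarrow> 'a \<Rightarrow> ereal) \<Rightarrow> real set \<Rightarrow> (real \<Rightarrow> 'a) \<Rightarrow> bool" where
  "causal_curve cv l I \<gamma> \<longleftrightarrow>
     cv I \<gamma> \<and> (\<forall>t\<in>I. \<forall>s\<in>I. t < s \<longrightarrow> causal_le l (\<gamma> t) (\<gamma> s))"

definition timelike_curve ::
    "'a curve_class \<Rightarrow> ('a \<Rightarrow> 'a \<Rightarrow> ereal) \<Rightarrow> real set \<Rightarrow> (real \<Rightarrow> 'a) \<Rightarrow> bool" where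
  "timelike_curve cv l I \<gamma> \<longleftrightarrow>
     cv I \<gamma> \<and> (\<forall>t\<in>I. \<forall>s\<in>I. t < s \<longrightarrow> chron_less l (\<gamma> t) (\<gamma> s))"

definition timelike_path_connected :: "'a curve_class \<Rightarrow> ('a \<Rightarrow> 'a \<Rightarrow> ereal) \<Rightarrow> bool" where
  "timelike_path_connected cv l \<longleftrightarrow>
     (\<forall>x y. chron_less l x y \<longrightarrow>
        (\<exists>a b \<gamma>. a < b \<and> timelike_curve cv l {a..b} \<gamma> \<and> \<gamma> a = x \<and> \<gamma> b = y))"

definition partition_of :: "real \<Rightarrow> real \<Rightarrow> nat \<Rightarrow> (nat \<Rightarrow> real) \<Rightarrow> bool" where
  "partition_of a b n t \<longleftrightarrow> t 0 = a \<and> t n = b \<and> (\<forall>i<n. t i < t (Suc i))"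

definition lor_length ::
    "('a \<Rightarrow> 'a \<Rightarrow> ereal) \<Rightarrow> real \<Rightarrow> real \<Rightarrow> (real \<Rightarrow> 'a) \<Rightarrow> ereal" where
  "lor_length l a b \<gamma> =
     Inf {(\<Sum>i<n. lor_dist l (\<gamma> (t i)) (\<gamma> (t (Suc i)))) | n t. partition_of a b n t}"

definition geodesic_space :: "'a curve_class \<Rightarrow> ('a \<Rightarrow> 'a \<Rightarrow> ereal) \<Rightarrow> bool" where
  "geodesic_space cv l \<longleftrightarrow>
     (\<forall>x y. causal_le l x y \<longrightarrow>
        (\<exists>a b \<gamma>. a < b \<and> causal_curve cv l {a..b} \<gamma> \<and> \<gamma> a = x \<and> \<gamma> b = y \<and>
                 lor_length l a b \<gamma> = lor_dist l x y))"

definition KS_lorentzian_pre_length_space ::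
    "'a::topological_space metric \<Rightarrow> ('a \<Rightarrow> 'a \<Rightarrow> ereal) \<Rightarrow> bool" where
  "KS_lorentzian_pre_length_space \<rho> l \<longleftrightarrow>
     lorentzian_pre_length_space l \<and> mtopology_of \<rho> = euclidean \<and>
     lower_semicontinuous_lor_dist l"

definition metric_arclength :: "'a metric \<Rightarrow> real set \<Rightarrow> (real \<Rightarrow> 'a) \<Rightarrow> ereal" where
  "metric_arclength \<rho> I \<gamma> =
     Sup {(\<Sum>i<n. ereal (mdist \<rho> (\<gamma> (t i)) (\<gamma> (t (Suc i))))) | n t a b.
            a \<in> I \<and> b \<in> I \<and> partition_of a b n t}"

definition metric_compatible ::
    "'a curve_class \<Rightarrow> 'a::topological_space metric \<Rightarrow> ('a \<Rightarrow> 'a \<Rightarrow> ereal) \<Rightarrow> bool" where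
  "metric_compatible cv \<rho> l \<longleftrightarrow>
     (\<forall>x. \<exists>U. x \<in> interior U \<and>
        (\<exists>C::real. 0 < C \<and>
           (\<forall>I \<gamma>. causal_curve cv l I \<gamma> \<longrightarrow> \<gamma> ` I \<subseteq> U \<longrightarrow>
              metric_arclength \<rho> I \<gamma> \<le> ereal C)))"


section \<open>Inextendible curves, Condition B, Cauchy sets\<close>

definition future_extendible ::
    "'a curve_class \<Rightarrow> ('a \<Rightarrow> 'a \<Rightarrow> ereal) \<Rightarrow> real set \<Rightarrow> (real \<Rightarrow> 'a) \<Rightarrow> bool" where
  "future_extendible cv l I \<gamma> \<longleftrightarrow>
     (\<exists>\<phi> \<psi> I' I'' \<gamma>'. is_interval I' \<and> homeomorphism I I' \<phi> \<psi> \<and> strict_mono_on I \<phi> \<and>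
        is_interval I'' \<and> I' \<subseteq> I'' \<and> (\<exists>t\<in>I''. \<forall>s\<in>I'. s < t) \<and>
        causal_curve cv l I'' \<gamma>' \<and> (\<forall>s\<in>I'. \<gamma>' s = \<gamma> (\<psi> s)))"

definition past_extendible ::
    "'a curve_class \<Rightarrow> ('a \<Rightarrow> 'a \<Rightarrow> ereal) \<Rightarrow> real set \<Rightarrow> (real \<Rightarrow> 'a) \<Rightarrow> bool" where
  "past_extendible cv l I \<gamma> \<longleftrightarrow>
     (\<exists>\<phi> \<psi> I' I'' \<gamma>'. is_interval I' \<and> homeomorphism I I' \<phi> \<psi> \<and> strict_mono_on I \<phi> \<and>
        is_interval I'' \<and> I' \<subseteq> I'' \<and> (\<exists>t\<in>I''. \<forall>s\<in>I'. t < s) \<and>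
        causal_curve cv l I'' \<gamma>' \<and> (\<forall>s\<in>I'. \<gamma>' s = \<gamma> (\<psi> s)))"

definition future_inext_timelike_curve ::
    "'a curve_class \<Rightarrow> ('a \<Rightarrow> 'a \<Rightarrow> ereal) \<Rightarrow> real set \<Rightarrow> (real \<Rightarrow> 'a) \<Rightarrow> bool" where
  "future_inext_timelike_curve cv l I \<gamma> \<longleftrightarrow>
     timelike_curve cv l I \<gamma> \<and> \<not> future_extendible cv l I \<gamma>"

definition past_inext_timelike_curve ::
    "'a curve_class \<Rightarrow> ('a \<Rightarrow> 'a \<Rightarrow> ereal) \<Rightarrow> real set \<Rightarrow> (real \<Rightarrow> 'a) \<Rightarrow> bool" where
  "past_inext_timelike_curve cv l I \<gamma> \<longleftrightarrow>
     timelike_curve cv l I \<gamma> \<and> \<not> past_extendible cv l I \<gamma>"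

definition inext_timelike_curve ::
    "'a curve_class \<Rightarrow> ('a \<Rightarrow> 'a \<Rightarrow> ereal) \<Rightarrow> real set \<Rightarrow> (real \<Rightarrow> 'a) \<Rightarrow> bool" where
  "inext_timelike_curve cv l I \<gamma> \<longleftrightarrow>
     timelike_curve cv l I \<gamma> \<and> \<not> future_extendible cv l I \<gamma> \<and> \<not> past_extendible cv l I \<gamma>"

text \<open>The endpoints \<open>sup I\<close> and \<open>inf I\<close> are taken in the extended reals, as \<open>I\<close> may be unbounded.\<close>

definition condition_B :: "'a curve_class \<Rightarrow> ('a \<Rightarrow> 'a \<Rightarrow> ereal) \<Rightarrow> bool" where
  "condition_B cv l \<longleftrightarrow>
     (\<forall>I \<gamma>. future_inext_timelike_curve cv l I \<gamma> \<longrightarrow>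
        (\<exists>t0\<in>I. \<exists>C::real. \<forall>t\<in>{t0..} \<inter> I. lor_dist l (\<gamma> t0) (\<gamma> t) \<le> ereal C) \<longrightarrow>
        Sup (ereal ` I) \<in> ereal ` I) \<and>
     (\<forall>I \<gamma>. past_inext_timelike_curve cv l I \<gamma> \<longrightarrow>
        (\<exists>t0\<in>I. \<exists>C::real. \<forall>t\<in>{..t0} \<inter> I. lor_dist l (\<gamma> t) (\<gamma> t0) \<le> ereal C) \<longrightarrow>
        Inf (ereal ` I) \<in> ereal ` I)"

definition cauchy_set :: "'a curve_class \<Rightarrow> ('a \<Rightarrow> 'a \<Rightarrow> ereal) \<Rightarrow> 'a set \<Rightarrow> bool" where
  "cauchy_set cv l S \<longleftrightarrow> (\<forall>I \<gamma>. inext_timelike_curve cv l I \<gamma> \<longrightarrow> (\<exists>!t. t \<in> I \<and> \<gamma> t \<in> S))"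


section \<open>Distance from a set, parallel sets, the function \<open>\<tau>\<close>\<close>

definition dJ :: "('a \<Rightarrow> 'a \<Rightarrow> ereal) \<Rightarrow> 'a set \<Rightarrow> 'a set \<Rightarrow> ereal" where
  "dJ l A B = (SUP (x, y)\<in>A \<times> B. lor_dist l x y + lor_dist l y x)"

definition dJ_pt :: "('a \<Rightarrow> 'a \<Rightarrow> ereal) \<Rightarrow> 'a set \<Rightarrow> 'a \<Rightarrow> ereal" where
  "dJ_pt l S x = dJ l {x} S"

text \<open>
  The boundary parts \<open>\<partial>\<^sup>\<plusminus>X\<close> in the next definition make sense for spaces without bubbling boundary,
  where the chronological version used here agrees with the causal one.
\<close>

definition parallel_set :: "('a \<Rightarrow> 'a \<Rightarrow> ereal) \<Rightarrow> 'a set \<Rightarrow> real \<Rightarrow> 'a set" where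
  "parallel_set l S t =
     (if t = 0 then S
      else if t > 0 then
        {x \<in> J_plus_set l S. dJ_pt l S x = ereal \<bar>t\<bar>} \<union>
        {x \<in> chron_bdry_plus l. dJ_pt l S x < ereal \<bar>t\<bar>}
      else
        {x \<in> J_minus_set l S. dJ_pt l S x = ereal \<bar>t\<bar>} \<union>
        {x \<in> chron_bdry_minus l. dJ_pt l S x < ereal \<bar>t\<bar>})"

text \<open>
  The case distinction defining \<open>\<tau>\<close> yields a real-valued function on the whole space only if the
  two cases exhaust the space, agree where they overlap, and have finite values.
\<close>

definition tau_well_defined :: "('a \<Rightarrow> 'a \<Rightarrow> ereal) \<Rightarrow> 'a set \<Rightarrow> bool" where
  "tau_well_defined l S \<longleftrightarrow>
     J_plus_set l S \<union> J_minus_set l S = UNIV \<and>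
     (\<forall>x\<in>J_plus_set l S \<inter> J_minus_set l S. dJ_pt l S x = - dJ_pt l S x) \<and>
     (\<forall>x. \<bar>dJ_pt l S x\<bar> \<noteq> \<infinity>)"

definition tau :: "('a \<Rightarrow> 'a \<Rightarrow> ereal) \<Rightarrow> 'a set \<Rightarrow> 'a \<Rightarrow> real" where
  "tau l S x =
     (if x \<in> J_plus_set l S then real_of_ereal (dJ_pt l S x)
      else if x \<in> J_minus_set l S then - real_of_ereal (dJ_pt l S x)
      else undefined)"

end

theory Submission
  imports Defs
begin

text \<open>
  The boundary being empty, Condition B makes the Lorentzian distance from the point of \<open>S\<close> on an
  inextendible timelike curve unbounded in both directions, which gives the limits of \<open>\<tau>\<close>.
  As \<open>S\<close> is achronal and meets an inextendible timelike curve through every point, the space is the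
  disjoint union of \<open>S\<close> and of the open sets where \<open>\<tau> > 0\<close> and \<open>\<tau> < 0\<close>.

  The main point is that \<open>d\<^sub>J(S, \<cdot>)\<close> is finite.  Otherwise the set \<open>F\<close> of all points of \<open>J\<^sup>-(S)\<close> where it
  is infinite is closed, contains the past of each of its points, and above each of its points
  contains another one, obtained from maximal geodesics to \<open>S\<close> by compactness.  A greedy
  construction then produces a timelike sequence in \<open>F\<close> without upper bound; it needs neither
  countability of the topology nor a limit curve theorem.  A timelike curve through this sequence
  that is also inextendible to the past has to meet \<open>S\<close>, necessarily at a point of \<open>F\<close>, although the
  distance vanishes on \<open>S\<close>.  The same construction with \<open>F\<close> the whole space provides the
  inextendible timelike curves.
\<close>

section \<open>Unbounded timelike sequences\<close>

text \<open>Finitely many members of a decreasing sequence all contain a single later one, which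
  gives the finite intersection property. Compact sets need not be closed without separation axioms,
  so \<open>K\<close> is kept apart from the closed sets.\<close>

lemma compact_decseq_nonempty:
  fixes C :: "nat \<Rightarrow> 'a::topological_space set"
  assumes "compact K" and closed: "\<And>n. closed (C n)" and dec: "\<And>n. C (Suc n) \<subseteq> C n"
    and ne: "\<And>n. K \<inter> C n \<noteq> {}"
  shows "K \<inter> (\<Inter>n. C n) \<noteq> {}"
proof (rule compact_imp_fip_image[OF \<open>compact K\<close> closed])
  fix I :: "nat set"
  assume fin: "finite I"
  obtain m where "\<And>i. i \<in> I \<Longrightarrow> i \<le> m"
    using fin finite_nat_set_iff_bounded_le by auto
  then have "C m \<subseteq> (\<Inter>i\<in>I. C i)"
    using lift_Suc_antimono_le[of C, OF dec] by blast
  then show "K \<inter> (\<Inter>i\<in>I. C i) \<noteq> {}"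
    using ne[of m] by blast
qed

text \<open>The axioms as a whole are invariant under time reversal, so past versions of results
  come by interpretation. Paths are normalised to \<open>{0..1}\<close> and merely continuous, which
  covers both kinds of admissible curves.\<close>

locale causal_structure =
  fixes D :: "'a::topological_space \<Rightarrow> 'a \<Rightarrow> real" and le :: "'a \<Rightarrow> 'a \<Rightarrow> bool"
  assumes D_nonneg: "0 \<le> D x y"
    and D_le: "0 < D x y \<Longrightarrow> le x y"
    and le_refl: "le x x"
    and le_trans: "le x y \<Longrightarrow> le y z \<Longrightarrow> le x z"
    and le_antisym: "le x y \<Longrightarrow> le y x \<Longrightarrow> x = y"
    and D_triangle: "le x y \<Longrightarrow> le y z \<Longrightarrow> D x y + D y z \<le> D x z"
    and closed_future: "closed {y. le x y}"
    and closed_past: "closed {y. le y x}"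
    and compact_diamond: "compact {y. le x y \<and> le y z}"
    and continuous_right: "continuous_on UNIV (D x)"
    and continuous_left: "continuous_on UNIV (\<lambda>x. D x y)"
    and timelike_path: "0 < D x y \<Longrightarrow> \<exists>\<sigma>. continuous_on {0..1::real} \<sigma> \<and> \<sigma> 0 = x \<and> \<sigma> 1 = y \<and>
      (\<forall>s t. 0 \<le> s \<longrightarrow> s < t \<longrightarrow> t \<le> 1 \<longrightarrow> 0 < D (\<sigma> s) (\<sigma> t))"
    and geodesic_path: "le x y \<Longrightarrow> \<exists>\<sigma>. continuous_on {0..1::real} \<sigma> \<and> \<sigma> 0 = x \<and> \<sigma> 1 = y \<and>
      (\<forall>t. 0 \<le> t \<longrightarrow> t \<le> 1 \<longrightarrow> le x (\<sigma> t) \<and> le (\<sigma> t) y \<and> D x (\<sigma> t) + D (\<sigma> t) y = D x y)"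
    and ex_future: "\<exists>y. 0 < D x y"
    and ex_past: "\<exists>y. 0 < D y x"
begin

lemma reversed: "causal_structure (\<lambda>x y. D y x) (\<lambda>x y. le y x)"
proof
  fix x y z :: 'a
  show "0 \<le> D y x" by (rule D_nonneg)
  show "le x x" by (rule le_refl)
  show "closed {y. le y x}" "closed {y. le x y}" by (rule closed_past closed_future)+
  show "continuous_on UNIV (\<lambda>y. D y x)" "continuous_on UNIV (D y)"
    by (rule continuous_left continuous_right)+
  show "\<exists>y. 0 < D y x" "\<exists>y. 0 < D x y" by (rule ex_past ex_future)+
  show "compact {y. le y x \<and> le z y}"
    using compact_diamond[of z x] by (simp add: conj_commute)
  show "le y x" if "0 < D y x" using that by (rule D_le)
  show "le z x" if "le y x" "le z y" using that by (blast intro: le_trans)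
  show "x = y" if "le y x" "le x y" using that by (blast intro: le_antisym)
  show "D y x + D z y \<le> D z x" if "le y x" "le z y"
    using D_triangle[OF that(2,1)] by simp
  have cont: "continuous_on {0..1} (\<lambda>t. \<sigma> (1 - t))" if "continuous_on {0..1} \<sigma>"
    for \<sigma> :: "real \<Rightarrow> 'a"
    by (rule continuous_on_compose2[OF that]) (auto intro!: continuous_intros)
  show "\<exists>\<sigma>. continuous_on {0..1} \<sigma> \<and> \<sigma> 0 = x \<and> \<sigma> 1 = y \<and>
      (\<forall>s t. 0 \<le> s \<longrightarrow> s < t \<longrightarrow> t \<le> (1::real) \<longrightarrow> 0 < D (\<sigma> t) (\<sigma> s))" if xy: "0 < D y x"
  proof -
    obtain \<sigma> where \<sigma>: "continuous_on {0..1} \<sigma>" "\<sigma> 0 = y" "\<sigma> 1 = x"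
      "\<And>s t. 0 \<le> s \<Longrightarrow> s < t \<Longrightarrow> t \<le> (1::real) \<Longrightarrow> 0 < D (\<sigma> s) (\<sigma> t)"
      using timelike_path[OF xy] by blast
    show ?thesis
      by (rule exI[of _ "\<lambda>t. \<sigma> (1 - t)"]) (use \<sigma> cont in auto)
  qed
  show "\<exists>\<sigma>. continuous_on {0..1::real} \<sigma> \<and> \<sigma> 0 = x \<and> \<sigma> 1 = y \<and>
      (\<forall>t. 0 \<le> t \<longrightarrow> t \<le> 1 \<longrightarrow> le (\<sigma> t) x \<and> le y (\<sigma> t) \<and> D (\<sigma> t) x + D y (\<sigma> t) = D y x)"
    if xy: "le y x"
  proof -
    obtain \<sigma> where \<sigma>: "continuous_on {0..1} \<sigma>" "\<sigma> 0 = y" "\<sigma> 1 = x"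
      "\<And>t. 0 \<le> t \<Longrightarrow> t \<le> (1::real) \<Longrightarrow>
        le y (\<sigma> t) \<and> le (\<sigma> t) x \<and> D y (\<sigma> t) + D (\<sigma> t) x = D y x"
      using geodesic_path[OF xy] by blast
    show ?thesis
      by (rule exI[of _ "\<lambda>t. \<sigma> (1 - t)"]) (use \<sigma> cont in \<open>auto simp: add.commute\<close>)
  qed
qed

section \<open>Push-up, monotonicity and openness of chronological futures and pasts\<close>

lemma D_le_trans: "0 < D x y \<Longrightarrow> le y z \<Longrightarrow> 0 < D x z"
  using D_triangle[of x y z] D_le[of x y] D_nonneg[of y z] by linarith

lemma le_D_trans: "le x y \<Longrightarrow> 0 < D y z \<Longrightarrow> 0 < D x z"
  using D_triangle[of x y z] D_le[of y z] D_nonneg[of x y] by linarith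

text \<open>If \<open>D x y = 0\<close>, nonnegativity suffices; otherwise \<open>D_le\<close>
  supplies the relation \<open>le x y\<close> that the reverse triangle inequality needs.\<close>

lemma D_mono_right: "le y z \<Longrightarrow> D x y \<le> D x z"
  using D_triangle[of x y z] D_le[of x y] D_nonneg[of x y] D_nonneg[of y z] D_nonneg[of x z]
  by linarith

lemma D_mono_left: "le x y \<Longrightarrow> D y z \<le> D x z"
  using D_triangle[of x y z] D_le[of y z] D_nonneg[of x y] D_nonneg[of y z] D_nonneg[of x z]
  by linarith

lemma D_self: "D x x = 0"
  using D_triangle[OF le_refl le_refl, of x] D_nonneg[of x x] by linarith

lemma open_future: "open {y. r < D x y}"
  using open_Collect_less[OF continuous_on_const continuous_right] by simp

lemma open_past: "open {y. r < D y x}"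
  using open_Collect_less[OF continuous_on_const continuous_left] by simp

text \<open>Late points of a timelike path from \<open>x\<close> to \<open>y\<close> qualify. This
  lets a greedy step stop just short of its target, which then remains in the chronological
  future.\<close>

lemma approx_past:
  assumes "0 < D x y" "open U" "y \<in> U"
  obtains y' where "y' \<in> U" "0 < D x y'" "0 < D y' y"
proof -
  obtain \<sigma> where \<sigma>: "continuous_on {0..1} \<sigma>" "\<sigma> 0 = x" "\<sigma> 1 = y"
    "\<And>s t. 0 \<le> s \<Longrightarrow> s < t \<Longrightarrow> t \<le> (1::real) \<Longrightarrow> 0 < D (\<sigma> s) (\<sigma> t)"
    using timelike_path[OF assms(1)] by blast
  have "(\<sigma> \<longlongrightarrow> \<sigma> 1) (at_left 1)"
    using \<sigma>(1) by (simp add: continuous_on_Icc_at_leftD)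
  then have "eventually (\<lambda>t. \<sigma> t \<in> U) (at_left 1)"
    using assms(2,3) \<sigma>(3) by (auto dest: topological_tendstoD)
  moreover have "eventually (\<lambda>t::real. t \<in> {0<..<1}) (at_left 1)"
    by (rule eventually_at_leftI) auto
  ultimately have "eventually (\<lambda>t. \<sigma> t \<in> U \<and> t \<in> {0<..<1}) (at_left 1)"
    by (rule eventually_conj)
  then obtain t where "\<sigma> t \<in> U" "0 < t" "t < 1"
    using eventually_happens'[of "at_left (1::real)"] by auto
  then show ?thesis
    using that[of "\<sigma> t"] \<sigma>(2,3) \<sigma>(4)[of 0 t] \<sigma>(4)[of t 1] by auto
qed

text \<open>The times at which the path is causally before \<open>z\<close> form a closed set, and
  \<open>t\<close> is its maximum. Were \<open>D (\<sigma> t) z\<close> positive, openness of the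
  chronological past of \<open>z\<close> would allow a later such time.\<close>

lemma exit_time:
  fixes \<sigma> :: "real \<Rightarrow> 'a"
  assumes cont: "continuous_on {0..1} \<sigma>" and start: "le (\<sigma> 0) z" and end_pt: "\<not> le (\<sigma> 1) z"
  obtains t where "0 \<le> t" "t < 1" "le (\<sigma> t) z" "D (\<sigma> t) z = 0"
proof -
  define T where "T = {0..1} \<inter> \<sigma> -` {v. le v z}"
  have "closed T"
    unfolding T_def using closed_vimage_Int[OF closed_past cont, of z] by (simp add: Int_commute)
  have bdd: "bdd_above T" unfolding T_def by (rule bdd_aboveI[of _ 1]) auto
  have "0 \<in> T" using start by (simp add: T_def)
  define t0 where "t0 = Sup T"
  have "t0 \<in> T"
    unfolding t0_def using closed_contains_Sup[OF _ bdd \<open>closed T\<close>] \<open>0 \<in> T\<close> by blast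
  then have t0: "0 \<le> t0" "t0 \<le> 1" "le (\<sigma> t0) z" by (auto simp: T_def)
  have "t0 \<noteq> 1" using t0(3) end_pt by auto
  then have "t0 < 1" using t0(2) by simp
  have "continuous_on {t0..1} \<sigma>"
    using cont t0 by (auto intro: continuous_on_subset)
  note lim_right = continuous_on_Icc_at_rightD[OF this \<open>t0 < 1\<close>]
  have "D (\<sigma> t0) z = 0"
  proof (rule ccontr)
    assume "D (\<sigma> t0) z \<noteq> 0"
    then have "\<sigma> t0 \<in> {v. 0 < D v z}" using D_nonneg[of "\<sigma> t0" z] by simp
    then have "eventually (\<lambda>t. \<sigma> t \<in> {v. 0 < D v z}) (at_right t0)"
      using topological_tendstoD[OF lim_right open_past] by blast
    moreover have "eventually (\<lambda>t. t \<in> {t0<..<1}) (at_right t0)"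
      using \<open>t0 < 1\<close> by (intro eventually_at_rightI[of _ 1]) auto
    ultimately have "eventually (\<lambda>t. \<sigma> t \<in> {v. 0 < D v z} \<and> t \<in> {t0<..<1}) (at_right t0)"
      by (rule eventually_conj)
    then obtain t where t: "0 < D (\<sigma> t) z" "t0 < t" "t < 1"
      using eventually_happens'[of "at_right t0"] by auto
    then have "t \<in> T" using t0 D_le by (auto simp: T_def)
    then have "t \<le> t0" unfolding t0_def using bdd by (rule cSup_upper)
    then show False using t by simp
  qed
  then show ?thesis using that t0 \<open>t0 < 1\<close> by blast
qed

section \<open>Cluster points of bounded timelike sequences and the greedy construction\<close>

lemma monotone_seq:
  assumes "\<And>k. 0 < D (y k) (y (Suc k))" and "m \<le> n"
  shows "le (y m) (y n)"
  using assms(2)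
proof (induction n rule: dec_induct)
  case base
  show ?case by (rule le_refl)
next
  case (step n)
  then show ?case using le_trans D_le[OF assms(1)[of n]] by blast
qed

text \<open>The closures of the tails have a common point \<open>z\<close> in the compact diamond
  from \<open>y 0\<close> to \<open>u\<close>. It is an upper bound since the future of
  \<open>y k\<close> is closed and contains a tail. One index per neighbourhood is enough later on,
  because the sequence is increasing.\<close>

lemma bounded_seq_cluster:
  assumes tl: "\<And>k. 0 < D (y k) (y (Suc k))" and "\<And>k. le (y k) u"
  obtains z where "\<And>k. le (y k) z" "\<And>U. open U \<Longrightarrow> z \<in> U \<Longrightarrow> \<exists>k. y k \<in> U"
proof -
  have "{v. le (y 0) v \<and> le v u} \<inter> (\<Inter>n. closure (y ` {n..})) \<noteq> {}"
  proof (rule compact_decseq_nonempty[OF compact_diamond])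
    show "closure (y ` {Suc n..}) \<subseteq> closure (y ` {n..})" for n
      by (intro closure_mono image_mono) auto
    have "y n \<in> closure (y ` {n..})" for n
      using closure_subset[of "y ` {n..}"] by auto
    then show "{v. le (y 0) v \<and> le v u} \<inter> closure (y ` {n..}) \<noteq> {}" for n
      using monotone_seq[of y 0 n, OF tl] assms(2)[of n] by blast
  qed simp
  then obtain z where z: "z \<in> closure (y ` {n..})" for n
    by blast
  have "closure (y ` {k..}) \<subseteq> {v. le (y k) v}" for k
    by (rule closure_minimal[OF _ closed_future]) (use monotone_seq[of y, OF tl] in auto)
  then have "le (y k) z" for k
    using z[of k] by blast
  moreover have "\<exists>k. y k \<in> U" if "open U" "z \<in> U" for U
    using z[of 0] that open_Int_closure_eq_empty[of U "y ` {0..}"] by auto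
  ultimately show ?thesis by (rule that)
qed

text \<open>Dini's theorem for the increasing functions \<open>\<lambda>c. D c (y k)\<close> on the diamond between \<open>p\<close> and \<open>z\<close>.\<close>

lemma uniform_approx:
  assumes tl: "\<And>k. 0 < D (y k) (y (Suc k))"
    and cluster: "\<And>U. open U \<Longrightarrow> z \<in> U \<Longrightarrow> \<exists>k. y k \<in> U"
    and e: "0 < e"
  obtains N where "\<And>k c. N \<le> k \<Longrightarrow> le p c \<Longrightarrow> le c z \<Longrightarrow> D c z - D c (y k) < e"
proof -
  \<comment> \<open>The points at which the error at stage \<open>k\<close> is still at least
    \<open>e\<close>; these closed sets decrease because \<open>D c (y k)\<close> increases with
    \<open>k\<close>.\<close>
  define C where "C k = {c. D c (y k) + e \<le> D c z}" for k
  have "\<exists>N. {c. le p c \<and> le c z} \<inter> C N = {}"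
  proof (rule ccontr)
    assume "\<nexists>N. {c. le p c \<and> le c z} \<inter> C N = {}"
    then have ne: "\<And>n. {c. le p c \<and> le c z} \<inter> C n \<noteq> {}" by blast
    have "{c. le p c \<and> le c z} \<inter> (\<Inter>n. C n) \<noteq> {}"
    proof (rule compact_decseq_nonempty[OF compact_diamond _ _ ne])
      show "closed (C n)" for n
        unfolding C_def by (intro closed_Collect_le continuous_intros continuous_left)
      show "C (Suc n) \<subseteq> C n" for n
      proof
        fix c
        assume "c \<in> C (Suc n)"
        then show "c \<in> C n"
          using D_mono_right[OF D_le[OF tl[of n]], of c] by (simp add: C_def)
      qed
    qed
    then obtain c where c: "\<And>n. D c (y n) + e \<le> D c z"
      by (auto simp: C_def)
    \<comment> \<open>For this fixed \<open>c\<close>, the points at distance more than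
      \<open>D c z - e\<close> from \<open>c\<close> form an open neighbourhood of \<open>z\<close>,
      which the sequence enters.\<close>
    obtain k where "D c z - e < D c (y k)"
      using cluster[OF open_future[of "D c z - e" c]] e by auto
    then show False using c[of k] by linarith
  qed
  then obtain N where N: "{c. le p c \<and> le c z} \<inter> C N = {}" by blast
  show ?thesis
  proof (rule that[of N])
    fix k c
    assume "N \<le> k" "le p c" "le c z"
    then have "D c z - D c (y N) < e" "D c (y N) \<le> D c (y k)"
      using N D_mono_right[OF monotone_seq[of y, OF tl \<open>N \<le> k\<close>]] by (force simp: C_def)+
    then show "D c z - D c (y k) < e" by linarith
  qed
qed

text \<open>
  A greedy choice: up to truncation and the error \<open>e\<close>, no point of \<open>F\<close> in the future of \<open>v\<close> gains
  more distance from the points of the diamond between \<open>p\<close> and \<open>v\<close> than \<open>v'\<close> does.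
\<close>

definition greedy_step :: "'a set \<Rightarrow> 'a \<Rightarrow> real \<Rightarrow> 'a \<Rightarrow> 'a \<Rightarrow> bool" where
  "greedy_step F p e v v' \<longleftrightarrow> (\<exists>w\<in>F. 0 < D v' w) \<and> 0 < D v v' \<and>
     (\<forall>w\<in>F. 0 < D v w \<longrightarrow> (\<forall>c. le p c \<longrightarrow> le c v \<longrightarrow>
        (\<exists>c'. le p c' \<and> le c' v \<and> min 1 (D c w - D c v) \<le> D c' v' - D c' v + e)))"

text \<open>Truncation at 1 makes the supremum of the possible gains finite. Some pair
  \<open>c0\<close>, \<open>w0\<close> comes within \<open>e / 2\<close> of it, and moving from
  \<open>w0\<close> slightly back to \<open>v'\<close> costs at most another \<open>e / 2\<close>
  while keeping \<open>w0\<close> in the chronological future of \<open>v'\<close>.\<close>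

lemma ex_greedy_step:
  assumes "w1 \<in> F" "0 < D v w1" "le p v" "0 < e"
  shows "\<exists>v'. greedy_step F p e v v'"
proof -
  define A where
    "A = {min 1 (D c w - D c v) | c w. w \<in> F \<and> 0 < D v w \<and> le p c \<and> le c v}"
  have bdd: "bdd_above A"
    by (rule bdd_aboveI[of _ 1]) (auto simp: A_def)
  have "A \<noteq> {}"
    using assms le_refl[of v] unfolding A_def by blast
  then obtain a where "a \<in> A" "Sup A - e / 2 < a"
    using less_cSup_iff[OF _ bdd, of "Sup A - e / 2"] assms(4) by auto
  then obtain c0 w0 where cw: "w0 \<in> F" "0 < D v w0" "le p c0" "le c0 v"
    and a: "Sup A - e / 2 < min 1 (D c0 w0 - D c0 v)"
    unfolding A_def by blast
  obtain v' where v': "D c0 w0 - e / 2 < D c0 v'" "0 < D v v'" "0 < D v' w0"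
    using approx_past[OF cw(2) open_future[of "D c0 w0 - e / 2" c0]] assms(4) by auto
  have "min 1 (D c w - D c v) \<le> D c0 v' - D c0 v + e"
    if "w \<in> F" "0 < D v w" "le p c" "le c v" for w c
  proof -
    have "min 1 (D c w - D c v) \<in> A"
      using that unfolding A_def by blast
    then have "min 1 (D c w - D c v) \<le> Sup A"
      using bdd by (rule cSup_upper)
    then show ?thesis using a v'(1) by linarith
  qed
  then have "greedy_step F p e v v'"
    unfolding greedy_step_def using v' cw by blast
  then show ?thesis ..
qed

text \<open>If \<open>w\<close> were farther from \<open>c\<close> than \<open>z\<close> is, it
  would offer a gain bounded away from zero at every stage. The greedy steps would then have to keep
  gaining a fixed amount at points of the diamond between \<open>p\<close> and \<open>z\<close>,
  contrary to uniform convergence there.\<close>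

lemma greedy_seq_limit:
  assumes tl: "\<And>k. 0 < D (y k) (y (Suc k))"
    and greedy: "\<And>k. greedy_step F p (1 / Suc k) (y k) (y (Suc k))"
    and ub: "\<And>k. le (y k) z"
    and cluster: "\<And>U. open U \<Longrightarrow> z \<in> U \<Longrightarrow> \<exists>k. y k \<in> U"
    and w: "w \<in> F" "le z w" and c: "le p c" "le c (y m)"
  shows "D c w = D c z"
proof (rule ccontr)
  assume neq: "D c w \<noteq> D c z"
  \<comment> \<open>Half of the truncated gap: one half absorbs the greedy error
    \<open>1 / Suc k\<close>, the other the gain still possible after stage
    \<open>N\<close>.\<close>
  define e where "e = min 1 (D c w - D c z) / 2"
  have "0 < e"
    using neq D_mono_right[OF w(2), of c] by (simp add: e_def)
  obtain N where N: "\<And>k c. N \<le> k \<Longrightarrow> le p c \<Longrightarrow> le c z \<Longrightarrow> D c z - D c (y k) < e"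
    using uniform_approx[of y, OF tl cluster \<open>0 < e\<close>] by metis
  obtain n where n: "inverse (real (Suc n)) < e"
    using reals_Archimedean[OF \<open>0 < e\<close>] by blast
  \<comment> \<open>Beyond \<open>N\<close> convergence is uniform up to \<open>e\<close>, beyond
    \<open>n\<close> the greedy error is below \<open>e\<close>, and beyond \<open>m\<close> the
    point \<open>c\<close> is among those tested.\<close>
  define k where "k = max N (max n m)"
  have "1 / real (Suc k) \<le> inverse (real (Suc n))"
    by (simp add: k_def field_simps)
  then have k: "1 / real (Suc k) < e" using n by linarith
  have ck: "le c (y k)"
    using le_trans[OF c(2) monotone_seq[of y m k, OF tl]] by (simp add: k_def)
  have "0 < D (y k) w"
    using D_le_trans[OF tl le_trans[OF ub w(2)]] .
  then obtain c' where c': "le p c'" "le c' (y k)"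
    "min 1 (D c w - D c (y k)) \<le> D c' (y (Suc k)) - D c' (y k) + 1 / Suc k"
    using greedy[of k] w(1) c(1) ck unfolding greedy_step_def by blast
  have "D c' (y (Suc k)) \<le> D c' z" "D c (y k) \<le> D c z"
    using D_mono_right ub by blast+
  moreover have "D c' z - D c' (y k) < e"
    using N[of k c'] c' le_trans[OF c'(2) ub] by (simp add: k_def)
  moreover have "2 * e = min 1 (D c w - D c z)" by (simp add: e_def)
  ultimately show False using c'(3) k by linarith
qed

text \<open>
  A greedy sequence that stays bounded accumulates at some \<open>z\<close> such that a point \<open>w\<close> of \<open>F\<close> above
  \<open>z\<close> is not farther away than \<open>z\<close> from any point chronologically before \<open>z\<close>.  On a timelike path
  towards \<open>w\<close>, the last point \<open>c\<close> before \<open>z\<close> then has \<open>D c w = D c z = 0\<close>.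
\<close>

theorem unbounded_timelike_seq:
  assumes "closed F" and past: "\<And>x y. y \<in> F \<Longrightarrow> le x y \<Longrightarrow> x \<in> F"
    and next_pt: "\<And>z. z \<in> F \<Longrightarrow> \<exists>w\<in>F. le z w \<and> z \<noteq> w"
    and x0: "w0 \<in> F" "0 < D x0 w0"
  shows "\<exists>y. y 0 = x0 \<and> (\<forall>k. 0 < D (y k) (y (Suc k))) \<and> (\<forall>k. y k \<in> F) \<and>
    (\<forall>u. \<exists>k. \<not> le (y k) u)"
proof -
  \<comment> \<open>Starting the diamonds strictly before \<open>x0\<close> ensures
    \<open>0 < D p z\<close> for every upper bound \<open>z\<close> of the sequence, so that a
    timelike path from \<open>p\<close> starts out chronologically before \<open>z\<close>.\<close>
  obtain p where p: "0 < D p x0" using ex_past by blast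
  \<comment> \<open>The invariant keeps a point of \<open>F\<close> chronologically ahead, without
    which there would be no next greedy step.\<close>
  have "\<exists>y. \<forall>k. ((\<exists>w\<in>F. 0 < D (y k) w) \<and> le x0 (y k) \<and> (k = 0 \<longrightarrow> y k = x0)) \<and>
      greedy_step F p (1 / Suc k) (y k) (y (Suc k))"
  proof (rule dependent_nat_choice)
    show "\<exists>x. (\<exists>w\<in>F. 0 < D x w) \<and> le x0 x \<and> (0 = (0::nat) \<longrightarrow> x = x0)"
      using x0 le_refl by blast
    fix v and k :: nat
    assume v: "(\<exists>w\<in>F. 0 < D v w) \<and> le x0 v \<and> (k = 0 \<longrightarrow> v = x0)"
    have "le p v" using le_trans[OF D_le[OF p]] v by blast
    then obtain v' where v': "greedy_step F p (1 / Suc k) v v'"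
      using v ex_greedy_step[of _ F v p "1 / Suc k"] by auto
    then have "\<exists>w\<in>F. 0 < D v' w" "0 < D v v'"
      unfolding greedy_step_def by blast+
    then show "\<exists>v'. ((\<exists>w\<in>F. 0 < D v' w) \<and> le x0 v' \<and> (Suc k = 0 \<longrightarrow> v' = x0)) \<and>
        greedy_step F p (1 / Suc k) v v'"
      using v v' le_trans[OF _ D_le[of v v']] by blast
  qed
  then obtain y where y: "\<And>k. \<exists>w\<in>F. 0 < D (y k) w" "y 0 = x0"
    "\<And>k. greedy_step F p (1 / Suc k) (y k) (y (Suc k))" by blast
  have tl: "0 < D (y k) (y (Suc k))" for k
    using y(3) unfolding greedy_step_def by blast
  have yF: "y k \<in> F" for k using y(1)[of k] past D_le by blast
  have False if u: "\<And>k. le (y k) u" for u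
  proof -
    obtain z where z: "\<And>k. le (y k) z" "\<And>U. open U \<Longrightarrow> z \<in> U \<Longrightarrow> \<exists>k. y k \<in> U"
      using bounded_seq_cluster[of y, OF tl u] by metis
    have "z \<in> F"
      using z(2)[of "- F"] yF \<open>closed F\<close> by auto
    then obtain w where w: "w \<in> F" "le z w" "z \<noteq> w" using next_pt by blast
    have eq: "D c w = D c z" if pc: "le p c" and cz: "0 < D c z" for c
    proof -
      obtain m where "0 < D c (y m)"
        using z(2)[OF open_future[of 0 c]] cz by auto
      then show ?thesis
        using greedy_seq_limit[of y F p z w c m, OF tl y(3) z w(1,2) pc] D_le by blast
    qed
    have pz: "0 < D p z" using D_le_trans[OF p] z(1)[of 0] y(2) by simp
    obtain \<sigma> where \<sigma>: "continuous_on {0..1} \<sigma>" "\<sigma> 0 = p" "\<sigma> 1 = w"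
      "\<And>s t. 0 \<le> s \<Longrightarrow> s < t \<Longrightarrow> t \<le> (1::real) \<Longrightarrow> 0 < D (\<sigma> s) (\<sigma> t)"
      using timelike_path[OF D_le_trans[OF pz w(2)]] by blast
    have "\<not> le w z" using w le_antisym by blast
    then obtain t0 where t0: "0 \<le> t0" "t0 < 1" "le (\<sigma> t0) z" "D (\<sigma> t0) z = 0"
      by (rule exit_time[OF \<sigma>(1), of z, unfolded \<sigma>(2,3), OF D_le[OF pz]])
    have cont_left: "continuous_on {0..t0} \<sigma>"
      using \<sigma>(1) t0 by (auto intro: continuous_on_subset)
    have "0 < t0" using pz \<sigma>(2) t0(1,4) by (cases "t0 = 0") auto
    have lims: "((\<lambda>t. D (\<sigma> t) v) \<longlongrightarrow> D (\<sigma> t0) v) (at_left t0)" for v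
      using continuous_on_compose2[OF continuous_left cont_left, of v] \<open>0 < t0\<close>
      by (intro continuous_on_Icc_at_leftD) auto
    \<comment> \<open>Before \<open>t0\<close> the path is chronologically before \<open>z\<close>
      by push-up, so \<open>eq\<close> applies there; continuity then carries the equality to
      \<open>t0\<close>.\<close>
    have "eventually (\<lambda>t. D (\<sigma> t) w = D (\<sigma> t) z) (at_left t0)"
    proof (rule eventually_at_leftI)
      fix t assume t: "t \<in> {0<..<t0}"
      show "D (\<sigma> t) w = D (\<sigma> t) z"
        using eq[of "\<sigma> t"] D_le[OF \<sigma>(4)[of 0 t]] D_le_trans[OF \<sigma>(4)[of t t0] t0(3)] t t0(2) \<sigma>(2)
        by simp
    qed (rule \<open>0 < t0\<close>)
    then have "((\<lambda>t. D (\<sigma> t) w) \<longlongrightarrow> D (\<sigma> t0) z) (at_left t0)"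
      using lims[of z] by (simp add: tendsto_cong)
    then have "D (\<sigma> t0) w = D (\<sigma> t0) z"
      using tendsto_unique[OF _ lims[of w]] by simp
    moreover have "0 < D (\<sigma> t0) w" using \<sigma>(4)[of t0 1] \<sigma>(3) t0(1,2) by simp
    ultimately show False using t0(4) by simp
  qed
  then show ?thesis using y(2) tl yF by blast
qed

section \<open>Finiteness of the distance to \<open>S\<close> on its causal past\<close>

text \<open>
  If \<open>f\<close> is infinite at \<open>z\<close>, then geodesics from \<open>z\<close> to \<open>S\<close> of unbounded length leave the compact
  set of points between \<open>z\<close> and some \<open>q\<close> at points where \<open>f\<close> is unbounded, so that the continuous
  function \<open>f\<close> is infinite at some point after \<open>z\<close> as well.
\<close>

lemma infinite_next:
  fixes S :: "'a set"
  defines "f \<equiv> \<lambda>x. SUP s\<in>S. ereal (D x s + D s x)"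
  assumes achronal: "\<And>s s'. s \<in> S \<Longrightarrow> s' \<in> S \<Longrightarrow> D s s' = 0"
    and closed: "closed {x. \<exists>s\<in>S. le x s}"
    and cont: "continuous_on UNIV f"
    and z: "\<exists>s\<in>S. le z s" "f z = \<infinity>"
  shows "\<exists>w. (\<exists>s\<in>S. le w s) \<and> f w = \<infinity> \<and> le z w \<and> z \<noteq> w"
proof -
  \<comment> \<open>By push-up and achronality no point of \<open>J\<^sup>-(S)\<close> is
    chronologically after a point of \<open>S\<close>, so only the summand \<open>D x s\<close>
    matters there.\<close>
  have before: "D s x = 0" if "s \<in> S" "s' \<in> S" "le x s'" for x s s'
    using D_le_trans[OF _ that(3), of s] achronal[OF that(1,2)] D_nonneg[of s x] by linarith
  obtain q where q: "0 < D z q" using ex_future by blast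
  \<comment> \<open>The possible exit points. Removing the open chronological past of
    \<open>q\<close> preserves compactness and excludes \<open>z\<close>.\<close>
  define B where "B = {v. le z v \<and> le v q} \<inter> {v. \<exists>s\<in>S. le v s} \<inter> - {v. 0 < D v q}"
  have "compact B"
    unfolding B_def using closed open_past[of 0 q]
    by (intro compact_Int_closed compact_diamond) (auto simp: closed_Compl)
  have large: "\<exists>v\<in>B. ereal r \<le> f v" for r
  proof -
    \<comment> \<open>The initial leg of the geodesic ends before \<open>q\<close>, so its length is
      at most \<open>D z q\<close>; a total above \<open>R\<close> leaves at least \<open>r\<close>
      for the remaining leg. As \<open>R\<close> is also at least \<open>D z q\<close>, the endpoint
      \<open>s\<close> cannot be before \<open>q\<close>.\<close>
    define R where "R = max r 0 + D z q"
    have "ereal R < f z" using z(2) by simp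
    then obtain s where s: "s \<in> S" "R < D z s + D s z"
      unfolding f_def less_SUP_iff by auto
    have "D s z = 0" using z(1) before[OF s(1)] by blast
    then have Rs: "R < D z s" using s(2) by simp
    then have "le z s" using D_nonneg[of z q] by (intro D_le) (simp add: R_def)
    then obtain \<sigma> where \<sigma>: "continuous_on {0..1} \<sigma>" "\<sigma> 0 = z" "\<sigma> 1 = s"
      "\<And>t. 0 \<le> t \<Longrightarrow> t \<le> (1::real) \<Longrightarrow>
        le z (\<sigma> t) \<and> le (\<sigma> t) s \<and> D z (\<sigma> t) + D (\<sigma> t) s = D z s"
      using geodesic_path[of z s] by blast
    have "\<not> le s q"
      using D_mono_right[of s q z] Rs by (auto simp: R_def)
    then obtain t where t: "0 \<le> t" "t < 1" "le (\<sigma> t) q" "D (\<sigma> t) q = 0"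
      by (rule exit_time[OF \<sigma>(1), of q, unfolded \<sigma>(2,3), OF D_le[OF q]])
    have \<sigma>t: "le z (\<sigma> t)" "le (\<sigma> t) s" "D z (\<sigma> t) + D (\<sigma> t) s = D z s"
      using \<sigma>(4)[of t] t by auto
    have "r \<le> D (\<sigma> t) s + D s (\<sigma> t)"
      using \<sigma>t(3) Rs D_mono_right[OF t(3), of z] D_nonneg[of s "\<sigma> t"] by (simp add: R_def)
    then have "ereal r \<le> f (\<sigma> t)"
      unfolding f_def using s(1) by (intro SUP_upper2[of s]) auto
    moreover have "\<sigma> t \<in> B"
      unfolding B_def using \<sigma>t t s(1) by auto
    ultimately show ?thesis by blast
  qed
  then have "B \<noteq> {}" by blast
  then obtain w where w: "w \<in> B" "\<And>v. v \<in> B \<Longrightarrow> f v \<le> f w"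
    using continuous_attains_sup[OF \<open>compact B\<close> _ continuous_on_subset[OF cont]] by blast
  have "f w = \<infinity>"
  proof (rule ereal_top)
    fix r
    obtain v where "v \<in> B" and v: "ereal r \<le> f v" using large by blast
    from v show "ereal r \<le> f w" by (rule order_trans) (rule w(2)[OF \<open>v \<in> B\<close>])
  qed
  moreover have "z \<noteq> w" using w(1) q by (auto simp: B_def)
  ultimately show ?thesis using w(1) unfolding B_def by blast
qed

text \<open>The assumption \<open>hits\<close> is the sequential form of the Cauchy property. It is
  contradicted by an unbounded timelike sequence inside the set \<open>F\<close> of points before
  \<open>S\<close> at infinite distance, whose upward continuation comes from
  \<open>infinite_next\<close>.\<close>

theorem finite_before:
  fixes S :: "'a set"
  defines "f \<equiv> \<lambda>x. SUP s\<in>S. ereal (D x s + D s x)"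
  assumes achronal: "\<And>s s'. s \<in> S \<Longrightarrow> s' \<in> S \<Longrightarrow> D s s' = 0"
    and closed: "closed {x. \<exists>s\<in>S. le x s}"
    and cont: "continuous_on UNIV f"
    and hits: "\<And>y. (\<And>k. 0 < D (y k) (y (Suc k))) \<Longrightarrow> (\<And>u. \<exists>k. \<not> le (y k) u) \<Longrightarrow>
      \<exists>s\<in>S. \<exists>k. le s (y k)"
    and x: "s \<in> S" "le x s"
  shows "f x \<noteq> \<infinity>"
proof
  assume inf: "f x = \<infinity>"
  define F where "F = {x. \<exists>s\<in>S. le x s} \<inter> f -` {\<infinity>}"
  have before: "D s x = 0" if "s \<in> S" "s' \<in> S" "le x s'" for x s s'
    using D_le_trans[OF _ that(3), of s] achronal[OF that(1,2)] D_nonneg[of s x] by linarith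
  have past: "x \<in> F" if "y \<in> F" "le x y" for x y
  proof -
    have y: "\<exists>s\<in>S. le y s" "f y = \<infinity>" using that(1) by (auto simp: F_def)
    \<comment> \<open>Since \<open>y\<close> is before \<open>S\<close>, only the terms
      \<open>D y s\<close> count, and these increase when \<open>y\<close> is moved to the
      past.\<close>
    have "f y \<le> f x"
      unfolding f_def
    proof (rule SUP_mono)
      fix s assume "s \<in> S"
      then have "D y s + D s y \<le> D x s + D s x"
        using before[OF \<open>s \<in> S\<close>] y(1) D_mono_left[OF that(2), of s] D_nonneg[of s x] by force
      then show "\<exists>m\<in>S. ereal (D y s + D s y) \<le> ereal (D x m + D m x)"
        using \<open>s \<in> S\<close> by auto
    qed
    then show ?thesis using y le_trans[OF that(2)] by (auto simp: F_def)
  qed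
  have "closed F"
    unfolding F_def by (intro closed_Int closed closed_vimage cont) auto
  have next_pt: "\<exists>w\<in>F. le z w \<and> z \<noteq> w" if "z \<in> F" for z
    using infinite_next[of S z, OF achronal closed] cont that unfolding F_def f_def by blast
  obtain x0 where x0: "0 < D x0 x" using ex_past by blast
  have xF: "x \<in> F" using x inf by (auto simp: F_def)
  have "\<exists>y. y 0 = x0 \<and> (\<forall>k. 0 < D (y k) (y (Suc k))) \<and> (\<forall>k. y k \<in> F) \<and>
      (\<forall>u. \<exists>k. \<not> le (y k) u)"
    by (rule unbounded_timelike_seq[OF \<open>closed F\<close> _ _ xF x0]) (fact past, fact next_pt)
  then obtain y where y: "\<And>k. 0 < D (y k) (y (Suc k))" "\<And>k. y k \<in> F"
    "\<And>u. \<exists>k. \<not> le (y k) u" by blast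
  \<comment> \<open>The point \<open>s'\<close> inherits membership in \<open>F\<close> from the
    later point \<open>y k\<close>, whereas achronality gives \<open>f s' \<le> 0\<close>.\<close>
  obtain s' k where s': "s' \<in> S" "le s' (y k)"
    using hits[OF y(1,3)] by blast
  then have "s' \<in> F" using past y(2) by blast
  moreover have "f s' \<le> 0"
    unfolding f_def using achronal s'(1) by (intro SUP_least) simp
  ultimately show False by (simp add: F_def)
qed

end

section \<open>Gluing of curves\<close>

text \<open>The closure properties shared by continuous and locally Lipschitz curves that
  concatenation requires. In \<open>local\<close> the two sides of a point are separate, since at a
  junction the curve is known to be admissible on each side only.\<close>

locale gluing_curve_class =
  fixes cv :: "'a::topological_space curve_class"
  assumes is_interval: "cv I \<gamma> \<Longrightarrow> is_interval I"
    and continuous: "cv I \<gamma> \<Longrightarrow> continuous_on I \<gamma>"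
    and mono: "cv I \<gamma> \<Longrightarrow> is_interval J \<Longrightarrow> J \<subseteq> I \<Longrightarrow> cv J \<gamma>"
    and cong: "cv I \<gamma> \<Longrightarrow> (\<And>t. t \<in> I \<Longrightarrow> \<gamma> t = \<gamma>' t) \<Longrightarrow> cv I \<gamma>'"
    and affine: "cv J \<gamma> \<Longrightarrow> 0 < m \<Longrightarrow> is_interval I \<Longrightarrow> (\<And>t. t \<in> I \<Longrightarrow> m * t + c \<in> J) \<Longrightarrow>
      cv I (\<lambda>t. \<gamma> (m * t + c))"
    and local: "is_interval I \<Longrightarrow>
      (\<And>t. t \<in> I \<Longrightarrow> \<exists>e>0. cv (I \<inter> {t - e..t}) \<gamma> \<and> cv (I \<inter> {t..t + e}) \<gamma>) \<Longrightarrow> cv I \<gamma>"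

lemma continuous_on_local_sides:
  fixes \<gamma> :: "real \<Rightarrow> 'a::topological_space"
  assumes "\<And>t. t \<in> I \<Longrightarrow>
    \<exists>e>0. continuous_on (I \<inter> {t - e..t}) \<gamma> \<and> continuous_on (I \<inter> {t..t + e}) \<gamma>"
  shows "continuous_on I \<gamma>"
  unfolding continuous_on_def
proof
  fix t assume "t \<in> I"
  obtain e where e: "0 < e" "continuous_on (I \<inter> {t - e..t}) \<gamma>" "continuous_on (I \<inter> {t..t + e}) \<gamma>"
    using assms[OF \<open>t \<in> I\<close>] by blast
  have "(\<gamma> \<longlongrightarrow> \<gamma> t) (at t within (I \<inter> {t - e..t}) \<union> (I \<inter> {t..t + e}))"
    using e \<open>t \<in> I\<close> by (simp add: Lim_within_Un continuous_on_def)
  also have "at t within (I \<inter> {t - e..t}) \<union> (I \<inter> {t..t + e}) = at t within I"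
    by (rule at_within_nhd[of _ "{t - e<..<t + e}"]) (use e in auto)
  finally show "(\<gamma> \<longlongrightarrow> \<gamma> t) (at t within I)" .
qed

lemma gluing_continuous_curve: "gluing_curve_class continuous_curve"
proof
  fix I J :: "real set" and \<gamma> \<gamma>' :: "real \<Rightarrow> 'a" and m c :: real
  show "is_interval I" "continuous_on I \<gamma>" if "continuous_curve I \<gamma>"
    using that by (auto simp: continuous_curve_def)
  show "continuous_curve J \<gamma>" if "continuous_curve I \<gamma>" "is_interval J" "J \<subseteq> I"
    using that by (auto simp: continuous_curve_def intro: continuous_on_subset)
  show "continuous_curve I \<gamma>'" if "continuous_curve I \<gamma>" "\<And>t. t \<in> I \<Longrightarrow> \<gamma> t = \<gamma>' t"
    using that continuous_on_cong[of I I \<gamma> \<gamma>'] by (auto simp: continuous_curve_def)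
  show "continuous_curve I (\<lambda>t. \<gamma> (m * t + c))"
    if "continuous_curve J \<gamma>" "is_interval I" "\<And>t. t \<in> I \<Longrightarrow> m * t + c \<in> J"
  proof -
    have "continuous_on J \<gamma>" using that(1) by (simp add: continuous_curve_def)
    moreover have "continuous_on I (\<lambda>t. m * t + c)" by (intro continuous_intros)
    moreover have "(\<lambda>t. m * t + c) ` I \<subseteq> J" using that(3) by blast
    ultimately have "continuous_on I (\<lambda>t. \<gamma> (m * t + c))" by (rule continuous_on_compose2)
    then show ?thesis using that(2) by (simp add: continuous_curve_def)
  qed
  show "continuous_curve I \<gamma>" if "is_interval I" "\<And>t. t \<in> I \<Longrightarrow>
      \<exists>e>0. continuous_curve (I \<inter> {t - e..t}) \<gamma> \<and> continuous_curve (I \<inter> {t..t + e}) \<gamma>"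
    unfolding continuous_curve_def
  proof (intro conjI)
    show "continuous_on I \<gamma>"
    proof (rule continuous_on_local_sides)
      fix t assume "t \<in> I"
      then show "\<exists>e>0. continuous_on (I \<inter> {t - e..t}) \<gamma> \<and> continuous_on (I \<inter> {t..t + e}) \<gamma>"
        using that(2)[of t] unfolding continuous_curve_def by blast
    qed
  qed (rule that(1))
qed

section \<open>Locally Lipschitz curves\<close>

definition lipschitz_near :: "'a metric \<Rightarrow> real set \<Rightarrow> (real \<Rightarrow> 'a) \<Rightarrow> real \<Rightarrow> real \<Rightarrow> real \<Rightarrow> bool" where
  "lipschitz_near \<rho> I \<gamma> t e K \<longleftrightarrow>
     (\<forall>r\<in>I \<inter> ball t e. \<forall>s\<in>I \<inter> ball t e. mdist \<rho> (\<gamma> r) (\<gamma> s) \<le> K * \<bar>r - s\<bar>)"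

lemma lipschitz_curve_iff:
  "lipschitz_curve \<rho> I \<gamma> \<longleftrightarrow>
     continuous_curve I \<gamma> \<and> (\<forall>t\<in>I. \<exists>e>0. \<exists>K. lipschitz_near \<rho> I \<gamma> t e K)"
  unfolding lipschitz_curve_def lipschitz_near_def ..

lemma lipschitz_nearD:
  "lipschitz_near \<rho> I \<gamma> t e K \<Longrightarrow> r \<in> I \<Longrightarrow> s \<in> I \<Longrightarrow> r \<in> ball t e \<Longrightarrow> s \<in> ball t e \<Longrightarrow>
    mdist \<rho> (\<gamma> r) (\<gamma> s) \<le> K * \<bar>r - s\<bar>"
  unfolding lipschitz_near_def by blast

lemma lipschitz_near_mono:
  "lipschitz_near \<rho> I \<gamma> t e K \<Longrightarrow> J \<inter> ball t e' \<subseteq> I \<inter> ball t e \<Longrightarrow> K \<le> K' \<Longrightarrow>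
    lipschitz_near \<rho> J \<gamma> t e' K'"
proof (unfold lipschitz_near_def, intro ballI)
  fix r s
  assume lip: "\<forall>r\<in>I \<inter> ball t e. \<forall>s\<in>I \<inter> ball t e. mdist \<rho> (\<gamma> r) (\<gamma> s) \<le> K * \<bar>r - s\<bar>"
    and sub: "J \<inter> ball t e' \<subseteq> I \<inter> ball t e" and "K \<le> K'"
    and rs: "r \<in> J \<inter> ball t e'" "s \<in> J \<inter> ball t e'"
  have "mdist \<rho> (\<gamma> r) (\<gamma> s) \<le> K * \<bar>r - s\<bar>" using lip sub rs by blast
  also have "\<dots> \<le> K' * \<bar>r - s\<bar>" using \<open>K \<le> K'\<close> by (intro mult_right_mono) auto
  finally show "mdist \<rho> (\<gamma> r) (\<gamma> s) \<le> K' * \<bar>r - s\<bar>" .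
qed

text \<open>Points on opposite sides of \<open>t\<close> are compared through
  \<open>\<gamma> t\<close>. The constant is preserved because
  \<open>\<bar>r - t\<bar> + \<bar>t - s\<bar> = \<bar>r - s\<bar>\<close> for \<open>t\<close>
  between \<open>r\<close> and \<open>s\<close>.\<close>

lemma lipschitz_near_sides:
  fixes \<rho> :: "'a metric"
  assumes \<rho>: "mspace \<rho> = UNIV" and "t \<in> I"
    and left: "lipschitz_near \<rho> (I \<inter> {..t}) \<gamma> t e K"
    and right: "lipschitz_near \<rho> (I \<inter> {t..}) \<gamma> t e K"
  shows "lipschitz_near \<rho> I \<gamma> t e K"
  unfolding lipschitz_near_def
proof (intro ballI)
  fix r s assume rs: "r \<in> I \<inter> ball t e" "s \<in> I \<inter> ball t e"
  have t: "t \<in> I \<inter> ball t e" using rs(1) \<open>t \<in> I\<close> by (auto intro: le_less_trans[OF zero_le_dist])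
  have across: "mdist \<rho> (\<gamma> r) (\<gamma> s) \<le> K * \<bar>r - s\<bar>"
    if "r \<in> I \<inter> ball t e" "s \<in> I \<inter> ball t e" "r \<le> t" "t \<le> s" for r s
  proof -
    have "mdist \<rho> (\<gamma> r) (\<gamma> s) \<le> mdist \<rho> (\<gamma> r) (\<gamma> t) + mdist \<rho> (\<gamma> t) (\<gamma> s)"
      using \<rho> by (intro mdist_triangle) auto
    also have "\<dots> \<le> K * \<bar>r - t\<bar> + K * \<bar>t - s\<bar>"
      using that t by (intro add_mono lipschitz_nearD[OF left] lipschitz_nearD[OF right]) auto
    also have "\<dots> = K * \<bar>r - s\<bar>"
      using that by (simp add: algebra_simps)
    finally show ?thesis .
  qed
  consider "r \<le> t" "s \<le> t" | "t \<le> r" "t \<le> s" | "r \<le> t" "t \<le> s" | "s \<le> t" "t \<le> r"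
    by linarith
  then show "mdist \<rho> (\<gamma> r) (\<gamma> s) \<le> K * \<bar>r - s\<bar>"
  proof cases
    case 1 then show ?thesis using rs by (intro lipschitz_nearD[OF left]) auto
  next
    case 2 then show ?thesis using rs by (intro lipschitz_nearD[OF right]) auto
  next
    case 3 then show ?thesis using across rs by blast
  next
    case 4 then show ?thesis using across[OF rs(2,1)] by (simp add: mdist_commute abs_minus_commute)
  qed
qed

lemma gluing_lipschitz_curve:
  fixes \<rho> :: "'a::topological_space metric"
  assumes \<rho>: "mspace \<rho> = UNIV"
  shows "gluing_curve_class (lipschitz_curve \<rho>)"
proof -
  interpret C: gluing_curve_class "continuous_curve :: 'a curve_class"
    by (rule gluing_continuous_curve)
  show ?thesis
  proof
    fix I J :: "real set" and \<gamma> \<gamma>' :: "real \<Rightarrow> 'a" and m c :: real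
    show "is_interval I" "continuous_on I \<gamma>" if "lipschitz_curve \<rho> I \<gamma>"
      using that C.is_interval C.continuous by (auto simp: lipschitz_curve_iff)
    show "lipschitz_curve \<rho> J \<gamma>"
      if curve: "lipschitz_curve \<rho> I \<gamma>" and J: "is_interval J" "J \<subseteq> I"
      unfolding lipschitz_curve_iff
    proof (intro conjI ballI)
      show "continuous_curve J \<gamma>"
        using curve J C.mono[of I \<gamma> J] by (simp add: lipschitz_curve_iff)
      fix t assume "t \<in> J"
      then obtain e K where "0 < e" "lipschitz_near \<rho> I \<gamma> t e K"
        using curve J(2) unfolding lipschitz_curve_iff by blast
      then show "\<exists>e>0. \<exists>K. lipschitz_near \<rho> J \<gamma> t e K"
        using lipschitz_near_mono[of \<rho> I \<gamma> t e K J e K] J(2) by blast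
    qed
    show "lipschitz_curve \<rho> I \<gamma>'"
      if curve: "lipschitz_curve \<rho> I \<gamma>" and eq: "\<And>t. t \<in> I \<Longrightarrow> \<gamma> t = \<gamma>' t"
    proof -
      have "lipschitz_near \<rho> I \<gamma>' = lipschitz_near \<rho> I \<gamma>"
        unfolding lipschitz_near_def fun_eq_iff using eq by simp
      then show ?thesis
        using curve C.cong[of I \<gamma> \<gamma>'] eq by (auto simp: lipschitz_curve_iff)
    qed
    show "lipschitz_curve \<rho> I (\<lambda>t. \<gamma> (m * t + c))"
      if curve: "lipschitz_curve \<rho> J \<gamma>" and m: "0 < m" and I: "is_interval I"
        and J: "\<And>t. t \<in> I \<Longrightarrow> m * t + c \<in> J"
      unfolding lipschitz_curve_iff
    proof (intro conjI ballI)
      show "continuous_curve I (\<lambda>t. \<gamma> (m * t + c))"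
        using curve C.affine[OF _ m I J] by (simp add: lipschitz_curve_iff)
      fix t assume "t \<in> I"
      then obtain e K where eK: "0 < e" "lipschitz_near \<rho> J \<gamma> (m * t + c) e K"
        using curve J unfolding lipschitz_curve_iff by blast
      \<comment> \<open>The parameter change stretches lengths by \<open>m\<close>, hence the radius
        \<open>e / m\<close> here and the constant \<open>K * m\<close> below.\<close>
      have ball: "m * r + c \<in> J \<inter> ball (m * t + c) e" if r: "r \<in> I \<inter> ball t (e / m)" for r
      proof -
        have "dist (m * t + c) (m * r + c) = m * dist t r"
          using m by (simp add: dist_real_def right_diff_distrib[symmetric] abs_mult)
        then show ?thesis using r J[of r] m by (simp add: pos_less_divide_eq mult.commute)
      qed
      have "lipschitz_near \<rho> I (\<lambda>t. \<gamma> (m * t + c)) t (e / m) (K * m)"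
        unfolding lipschitz_near_def
      proof (intro ballI)
        fix r s assume rs: "r \<in> I \<inter> ball t (e / m)" "s \<in> I \<inter> ball t (e / m)"
        have "mdist \<rho> (\<gamma> (m * r + c)) (\<gamma> (m * s + c)) \<le> K * \<bar>(m * r + c) - (m * s + c)\<bar>"
          using eK(2) ball[OF rs(1)] ball[OF rs(2)] unfolding lipschitz_near_def by blast
        also have "\<dots> = K * m * \<bar>r - s\<bar>"
          using m by (simp add: right_diff_distrib[symmetric] abs_mult)
        finally show "mdist \<rho> (\<gamma> (m * r + c)) (\<gamma> (m * s + c)) \<le> K * m * \<bar>r - s\<bar>" .
      qed
      then show "\<exists>e>0. \<exists>K. lipschitz_near \<rho> I (\<lambda>t. \<gamma> (m * t + c)) t e K"
        using eK(1) m by (intro exI[of _ "e / m"]) auto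
    qed
    show "lipschitz_curve \<rho> I \<gamma>" if I: "is_interval I" and sides: "\<And>t. t \<in> I \<Longrightarrow>
        \<exists>e>0. lipschitz_curve \<rho> (I \<inter> {t - e..t}) \<gamma> \<and> lipschitz_curve \<rho> (I \<inter> {t..t + e}) \<gamma>"
      unfolding lipschitz_curve_iff
    proof (intro conjI ballI)
      show "continuous_curve I \<gamma>"
        using I
      proof (rule C.local)
        fix t assume "t \<in> I"
        then show "\<exists>e>0. continuous_curve (I \<inter> {t - e..t}) \<gamma> \<and> continuous_curve (I \<inter> {t..t + e}) \<gamma>"
          using sides[of t] unfolding lipschitz_curve_iff by blast
      qed
      fix t assume "t \<in> I"
      then obtain e where e: "0 < e"
        "lipschitz_curve \<rho> (I \<inter> {t - e..t}) \<gamma>" "lipschitz_curve \<rho> (I \<inter> {t..t + e}) \<gamma>"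
        using sides by blast
      have "t \<in> I \<inter> {t - e..t}" "t \<in> I \<inter> {t..t + e}" using \<open>t \<in> I\<close> e(1) by auto
      obtain e1 K1 where lip1: "0 < e1" "lipschitz_near \<rho> (I \<inter> {t - e..t}) \<gamma> t e1 K1"
        using e(2) \<open>t \<in> I \<inter> {t - e..t}\<close> unfolding lipschitz_curve_iff by blast
      obtain e2 K2 where lip2: "0 < e2" "lipschitz_near \<rho> (I \<inter> {t..t + e}) \<gamma> t e2 K2"
        using e(3) \<open>t \<in> I \<inter> {t..t + e}\<close> unfolding lipschitz_curve_iff by blast
      \<comment> \<open>With radius at most \<open>e\<close>, the half-lines ending at
        \<open>t\<close> and the intervals of length \<open>e\<close> agree inside the ball.\<close>
      define d where "d = min e (min e1 e2)"
      have "lipschitz_near \<rho> (I \<inter> {..t}) \<gamma> t d (max K1 K2)"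
        by (rule lipschitz_near_mono[OF lip1(2)]) (auto simp: d_def dist_real_def)
      moreover have "lipschitz_near \<rho> (I \<inter> {t..}) \<gamma> t d (max K1 K2)"
        by (rule lipschitz_near_mono[OF lip2(2)]) (auto simp: d_def dist_real_def)
      ultimately have "lipschitz_near \<rho> I \<gamma> t d (max K1 K2)"
        by (rule lipschitz_near_sides[OF \<rho> \<open>t \<in> I\<close>])
      moreover have "0 < d" using e lip1 lip2 by (simp add: d_def)
      ultimately show "\<exists>e>0. \<exists>K. lipschitz_near \<rho> I \<gamma> t e K" by blast
    qed
  qed
qed

context gluing_curve_class
begin

text \<open>Away from \<open>b\<close>, one-sided neighbourhoods of length
  \<open>\<bar>t - b\<bar>\<close> do not cross \<open>b\<close> and so lie in a single piece; at
  \<open>b\<close> each side belongs to one piece.\<close>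

lemma glue:
  assumes "cv I \<gamma>" "cv J \<gamma>" and b: "b \<in> I" "b \<in> J" and I: "I \<subseteq> {..b}" and J: "J \<subseteq> {b..}"
  shows "cv (I \<union> J) \<gamma>"
proof (rule local[of "I \<union> J" \<gamma>])
  have int: "is_interval I" "is_interval J"
    by (rule is_interval[OF assms(1)] is_interval[OF assms(2)])+
  then show IJ: "is_interval (I \<union> J)"
    unfolding is_interval_connected_1 using b by (intro connected_Un) auto
  fix t assume t: "t \<in> I \<union> J"
  show "\<exists>e>0. cv ((I \<union> J) \<inter> {t - e..t}) \<gamma> \<and> cv ((I \<union> J) \<inter> {t..t + e}) \<gamma>"
  proof -
    have restr: "cv ((I \<union> J) \<inter> {r..s}) \<gamma>" if "s \<le> b \<or> b \<le> r" for r s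
    proof -
      have "is_interval ((I \<union> J) \<inter> {r..s})"
        using IJ by (intro is_interval_Int) (auto simp: is_interval_cc)
      moreover have "(I \<union> J) \<inter> {r..s} \<subseteq> I \<or> (I \<union> J) \<inter> {r..s} \<subseteq> J"
        using that
      proof
        assume "s \<le> b"
        then have "x \<in> I" if "x \<in> J" "x \<le> s" for x
          using that subsetD[OF J that(1)] b(1) by (cases "x = b") auto
        then show ?thesis by auto
      next
        assume "b \<le> r"
        then have "x \<in> J" if "x \<in> I" "r \<le> x" for x
          using that subsetD[OF I that(1)] b(2) by (cases "x = b") auto
        then show ?thesis by auto
      qed
      ultimately show ?thesis using mono[OF assms(1)] mono[OF assms(2)] by blast
    qed
    show ?thesis
    proof (cases "t = b")
      case True
      then show ?thesis
        using restr[where r = "t - 1" and s = t] restr[where r = t and s = "t + 1"]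
        by (intro exI[of _ 1]) simp
    next
      case False
      then have "t - \<bar>t - b\<bar> \<ge> b \<or> t \<le> b" "t + \<bar>t - b\<bar> \<le> b \<or> b \<le> t" "0 < \<bar>t - b\<bar>"
        by linarith+
      then show ?thesis
        using restr[where r = "t - \<bar>t - b\<bar>" and s = t]
          restr[where r = t and s = "t + \<bar>t - b\<bar>"] by blast
    qed
  qed
qed

lemma glue_integers:
  assumes "\<And>k::int. cv {of_int k..of_int k + 1} \<gamma>"
  shows "cv UNIV \<gamma>"
proof (rule local[of UNIV \<gamma>])
  fix t :: real
  \<comment> \<open>Piece \<open>k\<close> covers the right side of \<open>t\<close> and piece
    \<open>j\<close> the left side; they differ exactly when \<open>t\<close> is an integer.\<close>
  define k where "k = \<lfloor>t\<rfloor>"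
  define j where "j = \<lceil>t\<rceil> - 1"
  define e where "e = min (of_int k + 1 - t) (t - of_int j)"
  have kj: "of_int k \<le> t" "t < of_int k + 1" "of_int j < t" "t \<le> of_int j + 1"
    unfolding k_def j_def by linarith+
  have "cv (UNIV \<inter> {t - e..t}) \<gamma>"
    by (rule mono[OF assms[of j]]) (use kj in \<open>auto simp: e_def is_interval_cc\<close>)
  moreover have "cv (UNIV \<inter> {t..t + e}) \<gamma>"
    by (rule mono[OF assms[of k]]) (use kj in \<open>auto simp: e_def is_interval_cc\<close>)
  moreover have "0 < e" using kj by (simp add: e_def)
  ultimately show "\<exists>e>0. cv (UNIV \<inter> {t - e..t}) \<gamma> \<and> cv (UNIV \<inter> {t..t + e}) \<gamma>" by blast
qed simp

end

section \<open>Inextendible timelike curves\<close>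

locale timelike_connected = gluing_curve_class cv
  for cv :: "'a::topological_space curve_class" +
  fixes l :: "'a \<Rightarrow> 'a \<Rightarrow> ereal"
  assumes chron_trans: "chron_less l x y \<Longrightarrow> chron_less l y z \<Longrightarrow> chron_less l x z"
    and chron_causal: "chron_less l x y \<Longrightarrow> causal_le l x y"
    and causal_trans: "causal_le l x y \<Longrightarrow> causal_le l y z \<Longrightarrow> causal_le l x z"
    and causal_refl: "causal_le l x x"
    and path_connected: "timelike_path_connected cv l"
begin

lemma timelike_unit_path:
  assumes "chron_less l x y"
  shows "\<exists>\<gamma>. timelike_curve cv l {0..1} \<gamma> \<and> \<gamma> 0 = x \<and> \<gamma> 1 = y"
proof -
  obtain a b \<gamma> where ab: "a < b" and \<gamma>: "timelike_curve cv l {a..b} \<gamma>" "\<gamma> a = x" "\<gamma> b = y"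
    using path_connected assms unfolding timelike_path_connected_def by blast
  have img: "(b - a) * t + a \<in> {a..b}" if "t \<in> {0..1}" for t
  proof -
    have "(b - a) * t \<le> (b - a) * 1" "0 \<le> (b - a) * t"
      using that ab by (auto intro!: mult_left_mono)
    then show ?thesis by simp
  qed
  have "cv {0..1} (\<lambda>t. \<gamma> ((b - a) * t + a))"
    by (rule affine[of "{a..b}"]) (use \<gamma>(1) ab img in \<open>auto simp: timelike_curve_def is_interval_cc\<close>)
  then have "timelike_curve cv l {0..1} (\<lambda>t. \<gamma> ((b - a) * t + a))"
    using \<gamma>(1) ab img unfolding timelike_curve_def by simp
  then show ?thesis
    using \<gamma>(2,3) by (intro exI[of _ "\<lambda>t. \<gamma> ((b - a) * t + a)"]) auto
qed

lemma chron_int_chain: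
  fixes y :: "int \<Rightarrow> 'a"
  assumes "\<And>k. chron_less l (y k) (y (k + 1))" and "j \<le> k"
  shows "y j = y k \<or> chron_less l (y j) (y k)"
  using assms(2)
proof (induction k rule: int_ge_induct)
  case (step k)
  then show ?case using chron_trans assms(1)[of k] by auto
qed simp

text \<open>Unit-time timelike paths between consecutive points are concatenated, the path from
  \<open>y k\<close> occupying the time interval from \<open>k\<close> to
  \<open>k + 1\<close>.\<close>

lemma timelike_curve_through:
  fixes y :: "int \<Rightarrow> 'a"
  assumes y: "\<And>k. chron_less l (y k) (y (k + 1))"
  obtains \<gamma> where "timelike_curve cv l UNIV \<gamma>" "\<And>k. \<gamma> (of_int k) = y k"
proof -
  obtain \<sigma> where \<sigma>: "\<And>k. timelike_curve cv l {0..1} (\<sigma> k)" "\<And>k. \<sigma> k 0 = y k"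
    "\<And>k. \<sigma> k 1 = y (k + 1)"
    using timelike_unit_path[OF y] by metis
  define \<gamma> where "\<gamma> t = \<sigma> \<lfloor>t\<rfloor> (t - of_int \<lfloor>t\<rfloor>)" for t
  have piece: "\<gamma> t = \<sigma> k (t - of_int k)" if "t \<in> {of_int k..of_int k + 1}" for t k
  proof (cases "t = of_int k + 1")
    \<comment> \<open>At the right end of piece \<open>k\<close> the floor has already jumped to
      \<open>k + 1\<close>; both pieces have the value \<open>y (k + 1)\<close> there.\<close>
    case True
    then have "\<lfloor>t\<rfloor> = k + 1" by linarith
    then show ?thesis using True \<sigma>(2,3) by (simp add: \<gamma>_def)
  next
    case False
    then have "\<lfloor>t\<rfloor> = k" using that by (simp add: floor_eq_iff)
    then show ?thesis by (simp add: \<gamma>_def)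
  qed
  have at_int: "\<gamma> (of_int k) = y k" for k
    using \<sigma>(2) by (simp add: \<gamma>_def)
  have "cv {of_int k..of_int k + 1} \<gamma>" for k
  proof (rule cong)
    show "cv {of_int k..of_int k + 1} (\<lambda>t. \<sigma> k (1 * t + - of_int k))"
      by (rule affine[of "{0..1}"])
        (use \<sigma>(1) in \<open>auto simp: timelike_curve_def is_interval_cc\<close>)
  qed (simp add: piece)
  then have "cv UNIV \<gamma>" by (rule glue_integers)
  have within: "chron_less l (\<gamma> t) (\<gamma> s)"
    if "t < s" "of_int k \<le> t" "s \<le> of_int k + 1" for t s and k :: int
    using that \<sigma>(1)[of k] piece[of t k] piece[of s k] by (auto simp: timelike_curve_def)
  \<comment> \<open>Times in different pieces are compared through the first integer after
    \<open>t\<close> and the last integer up to \<open>s\<close>, which may coincide with each other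
    or with \<open>s\<close>.\<close>
  have "chron_less l (\<gamma> t) (\<gamma> s)" if "t < s" for t s
  proof (cases "s \<le> of_int \<lfloor>t\<rfloor> + 1")
    case True
    then show ?thesis using within[of t s "\<lfloor>t\<rfloor>"] that by simp
  next
    case False
    have "chron_less l (\<gamma> t) (y (\<lfloor>t\<rfloor> + 1))"
      using within[of t "of_int (\<lfloor>t\<rfloor> + 1)" "\<lfloor>t\<rfloor>"] at_int[of "\<lfloor>t\<rfloor> + 1"]
      by simp
    moreover have "y (\<lfloor>t\<rfloor> + 1) = y \<lfloor>s\<rfloor> \<or> chron_less l (y (\<lfloor>t\<rfloor> + 1)) (y \<lfloor>s\<rfloor>)"
      using False by (intro chron_int_chain y) linarith
    moreover have "y \<lfloor>s\<rfloor> = \<gamma> s \<or> chron_less l (y \<lfloor>s\<rfloor>) (\<gamma> s)"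
    proof (cases "s = of_int \<lfloor>s\<rfloor>")
      case True
      then show ?thesis using at_int[of "\<lfloor>s\<rfloor>"] by simp
    next
      case False
      then have "of_int \<lfloor>s\<rfloor> < s" by linarith
      then show ?thesis
        using within[of "of_int \<lfloor>s\<rfloor>" s "\<lfloor>s\<rfloor>"] at_int[of "\<lfloor>s\<rfloor>"] by simp
    qed
    ultimately show ?thesis using chron_trans by metis
  qed
  then have "timelike_curve cv l UNIV \<gamma>"
    using \<open>cv UNIV \<gamma>\<close> by (simp add: timelike_curve_def)
  then show ?thesis using at_int that by blast
qed

text \<open>Any value of the extension at a parameter beyond the curve is an upper bound. In
  contrapositive form this proves inextendibility from unboundedness, without studying limits of the
  curve.\<close>

lemma future_extendible_bounded:
  assumes "future_extendible cv l I \<gamma>"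
  obtains u where "\<And>t. t \<in> I \<Longrightarrow> causal_le l (\<gamma> t) u"
proof -
  obtain \<phi> \<psi> I' I'' \<gamma>' r where ext: "homeomorphism I I' \<phi> \<psi>" "I' \<subseteq> I''" "r \<in> I''"
    "\<forall>s\<in>I'. s < r" "causal_curve cv l I'' \<gamma>'" "\<forall>s\<in>I'. \<gamma>' s = \<gamma> (\<psi> s)"
    using assms unfolding future_extendible_def by blast
  show ?thesis
  proof (rule that[of "\<gamma>' r"])
    fix t assume "t \<in> I"
    then have "\<phi> t \<in> I'" "\<psi> (\<phi> t) = t" using ext(1) by (auto simp: homeomorphism_def)
    then show "causal_le l (\<gamma> t) (\<gamma>' r)"
      using ext unfolding causal_curve_def by (metis subsetD)
  qed
qed

lemma past_extendible_bounded:
  assumes "past_extendible cv l I \<gamma>"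
  obtains u where "\<And>t. t \<in> I \<Longrightarrow> causal_le l u (\<gamma> t)"
proof -
  obtain \<phi> \<psi> I' I'' \<gamma>' r where ext: "homeomorphism I I' \<phi> \<psi>" "I' \<subseteq> I''" "r \<in> I''"
    "\<forall>s\<in>I'. r < s" "causal_curve cv l I'' \<gamma>'" "\<forall>s\<in>I'. \<gamma>' s = \<gamma> (\<psi> s)"
    using assms unfolding past_extendible_def by blast
  show ?thesis
  proof (rule that[of "\<gamma>' r"])
    fix t assume "t \<in> I"
    then have "\<phi> t \<in> I'" "\<psi> (\<phi> t) = t" using ext(1) by (auto simp: homeomorphism_def)
    then show "causal_le l (\<gamma>' r) (\<gamma> t)"
      using ext unfolding causal_curve_def by (metis subsetD)
  qed
qed

text \<open>An unbounded future sequence and an unbounded past sequence are joined at their common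
  start; unboundedness at integer times already rules out both kinds of extension.\<close>

lemma inextendible_curve_through:
  fixes f g :: "nat \<Rightarrow> 'a"
  assumes f: "\<And>k. chron_less l (f k) (f (Suc k))" "\<And>u. \<exists>k. \<not> causal_le l (f k) u"
    and g: "\<And>k. chron_less l (g (Suc k)) (g k)" "\<And>u. \<exists>k. \<not> causal_le l u (g k)"
    and "f 0 = g 0"
  shows "\<exists>\<gamma>. inext_timelike_curve cv l UNIV \<gamma> \<and>
    (\<forall>k. \<gamma> (real k) = f k) \<and> (\<forall>k. \<gamma> (- real k) = g k)"
proof -
  define y where "y k = (if 0 \<le> k then f (nat k) else g (nat (- k)))" for k :: int
  have "chron_less l (y k) (y (k + 1))" for k
  proof -
    consider "0 \<le> k" | "k = -1" | "k < -1" by linarith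
    then show ?thesis
    proof cases
      case 1
      then show ?thesis using f(1)[of "nat k"] by (simp add: y_def nat_add_distrib)
    next
      case 2
      then show ?thesis using g(1)[of 0] \<open>f 0 = g 0\<close> by (simp add: y_def)
    next
      case 3
      then have "nat (- k) = Suc (nat (- (k + 1)))" by simp
      then show ?thesis using g(1)[of "nat (- (k + 1))"] 3 by (simp add: y_def)
    qed
  qed
  then obtain \<gamma> where \<gamma>: "timelike_curve cv l UNIV \<gamma>" "\<And>k. \<gamma> (of_int k) = y k"
    using timelike_curve_through by metis
  have fk: "\<gamma> (real k) = f k" for k using \<gamma>(2)[of "int k"] by (simp add: y_def)
  have gk: "\<gamma> (- real k) = g k" for k
    using \<gamma>(2)[of "- int k"] \<open>f 0 = g 0\<close> by (auto simp: y_def)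
  have "\<not> future_extendible cv l UNIV \<gamma>"
    using future_extendible_bounded[of UNIV \<gamma>] f(2) fk by (metis UNIV_I)
  moreover have "\<not> past_extendible cv l UNIV \<gamma>"
    using past_extendible_bounded[of UNIV \<gamma>] g(2) gk by (metis UNIV_I)
  ultimately have "inext_timelike_curve cv l UNIV \<gamma>"
    using \<gamma>(1) by (simp add: inext_timelike_curve_def)
  then show ?thesis using fk gk by blast
qed

lemma causal_curve_glue:
  assumes "causal_curve cv l I \<gamma>" "causal_curve cv l J \<gamma>" "b \<in> I" "b \<in> J" "I \<subseteq> {..b}" "J \<subseteq> {b..}"
  shows "causal_curve cv l (I \<union> J) \<gamma>"
  unfolding causal_curve_def
proof (intro conjI ballI impI)
  show "cv (I \<union> J) \<gamma>"
    using assms by (intro glue[of I \<gamma> J b]) (auto simp: causal_curve_def)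
  fix t s assume ts: "t \<in> I \<union> J" "s \<in> I \<union> J" "t < s"
  have to_b: "causal_le l (\<gamma> t) (\<gamma> b)" if "t \<in> I" for t
    using that assms(1,3,5) causal_refl unfolding causal_curve_def
    by (cases "t = b") (auto simp: less_le)
  have from_b: "causal_le l (\<gamma> b) (\<gamma> s)" if "s \<in> J" for s
    using that assms(2,4,6) causal_refl unfolding causal_curve_def
    by (cases "s = b") (auto simp: less_le)
  consider "t \<in> I" "s \<in> I" | "t \<in> J" "s \<in> J" | "t \<in> I" "s \<in> J" | "t = b" "s = b"
    using ts assms(5,6) by force
  then show "causal_le l (\<gamma> t) (\<gamma> s)"
  proof cases
    case 1 then show ?thesis using assms(1) ts(3) unfolding causal_curve_def by blast
  next
    case 2 then show ?thesis using assms(2) ts(3) unfolding causal_curve_def by blast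
  next
    case 3 then show ?thesis using to_b from_b causal_trans by blast
  qed (use ts(3) in simp)
qed

lemma timelike_imp_causal_curve: "timelike_curve cv l I \<gamma> \<Longrightarrow> causal_curve cv l I \<gamma>"
  unfolding timelike_curve_def causal_curve_def using chron_causal by blast

text \<open>A timelike path towards \<open>q\<close> is appended on \<open>{b..b + 1}\<close>. As
  \<open>b\<close> is finite, the identity serves as reparametrisation.\<close>

lemma future_extendible_at_max:
  assumes \<gamma>: "timelike_curve cv l I \<gamma>" and b: "b \<in> I" "I \<subseteq> {..b}" and q: "chron_less l (\<gamma> b) q"
  shows "future_extendible cv l I \<gamma>"
proof -
  obtain \<sigma> where \<sigma>: "timelike_curve cv l {0..1} \<sigma>" "\<sigma> 0 = \<gamma> b"
    using timelike_unit_path[OF q] by blast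
  define \<gamma>' where "\<gamma>' t = (if t \<le> b then \<gamma> t else \<sigma> (t - b))" for t
  have "cv {b..b + 1} (\<lambda>t. \<sigma> (1 * t + - b))"
    by (rule affine[of "{0..1}"]) (use \<sigma>(1) in \<open>auto simp: timelike_curve_def is_interval_cc\<close>)
  then have "cv {b..b + 1} \<gamma>'"
    by (rule cong) (auto simp: \<gamma>'_def \<sigma>(2))
  moreover have "\<gamma>' t = \<sigma> (t - b)" if "t \<in> {b..b + 1}" for t
    using that \<sigma>(2) by (auto simp: \<gamma>'_def)
  ultimately have J: "timelike_curve cv l {b..b + 1} \<gamma>'"
    using \<sigma>(1) unfolding timelike_curve_def by auto
  have eq: "\<gamma>' t = \<gamma> t" if "t \<in> I" for t
    using that b(2) by (auto simp: \<gamma>'_def)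
  then have "timelike_curve cv l I \<gamma>'"
    using \<gamma> cong[of I \<gamma> \<gamma>'] unfolding timelike_curve_def by auto
  then have ext: "causal_curve cv l (I \<union> {b..b + 1}) \<gamma>'"
    using J b by (intro causal_curve_glue[of _ _ _ b] timelike_imp_causal_curve) auto
  have "is_interval I" using \<gamma> is_interval unfolding timelike_curve_def by blast
  moreover have "is_interval (I \<union> {b..b + 1})"
    using ext is_interval unfolding causal_curve_def by blast
  moreover have "homeomorphism I I id id" by (simp add: homeomorphism_def)
  moreover have "\<exists>t\<in>I \<union> {b..b + 1}. \<forall>s\<in>I. s < t"
    using b(2) by (intro bexI[of _ "b + 1"]) auto
  ultimately show ?thesis
    unfolding future_extendible_def using ext eq
    by (intro exI[of _ id] exI[of _ I] exI[of _ "I \<union> {b..b + 1}"] exI[of _ \<gamma>'])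
      (auto simp: strict_mono_on_def)
qed

text \<open>Time dual of the preceding lemma: a path arriving at \<open>\<gamma> b\<close> is put on
  \<open>{b - 1..b}\<close>.\<close>

lemma past_extendible_at_min:
  assumes \<gamma>: "timelike_curve cv l I \<gamma>" and b: "b \<in> I" "I \<subseteq> {b..}" and q: "chron_less l q (\<gamma> b)"
  shows "past_extendible cv l I \<gamma>"
proof -
  obtain \<sigma> where \<sigma>: "timelike_curve cv l {0..1} \<sigma>" "\<sigma> 1 = \<gamma> b"
    using timelike_unit_path[OF q] by blast
  define \<gamma>' where "\<gamma>' t = (if b \<le> t then \<gamma> t else \<sigma> (t - b + 1))" for t
  have "cv {b - 1..b} (\<lambda>t. \<sigma> (1 * t + (1 - b)))"
    by (rule affine[of "{0..1}"]) (use \<sigma>(1) in \<open>auto simp: timelike_curve_def is_interval_cc\<close>)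
  then have "cv {b - 1..b} \<gamma>'"
    by (rule cong) (auto simp: \<gamma>'_def \<sigma>(2) algebra_simps)
  moreover have "\<gamma>' t = \<sigma> (t - b + 1)" if "t \<in> {b - 1..b}" for t
    using that \<sigma>(2) by (auto simp: \<gamma>'_def)
  ultimately have J: "timelike_curve cv l {b - 1..b} \<gamma>'"
    using \<sigma>(1) unfolding timelike_curve_def by auto
  have eq: "\<gamma>' t = \<gamma> t" if "t \<in> I" for t
    using that b(2) by (auto simp: \<gamma>'_def)
  then have "timelike_curve cv l I \<gamma>'"
    using \<gamma> cong[of I \<gamma> \<gamma>'] unfolding timelike_curve_def by auto
  then have ext: "causal_curve cv l ({b - 1..b} \<union> I) \<gamma>'"
    using J b by (intro causal_curve_glue[of _ _ _ b] timelike_imp_causal_curve) auto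
  have "is_interval I" using \<gamma> is_interval unfolding timelike_curve_def by blast
  moreover have "is_interval ({b - 1..b} \<union> I)"
    using ext is_interval unfolding causal_curve_def by blast
  moreover have "homeomorphism I I id id" by (simp add: homeomorphism_def)
  moreover have "\<exists>t\<in>{b - 1..b} \<union> I. \<forall>s\<in>I. t < s"
    using b(2) by (intro bexI[of _ "b - 1"]) auto
  ultimately show ?thesis
    unfolding past_extendible_def using ext eq
    by (intro exI[of _ id] exI[of _ I] exI[of _ "{b - 1..b} \<union> I"] exI[of _ \<gamma>'])
      (auto simp: strict_mono_on_def)
qed

end

section \<open>Distance from a Cauchy set\<close>

text \<open>The Cauchy property enters only through achronality, covering and the crossing of
  unbounded timelike sequences. In this form time reversal merely exchanges
  \<open>hits_future\<close> and \<open>hits_past\<close>.\<close>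

locale cauchy_structure = causal_structure D le
  for D :: "'a::topological_space \<Rightarrow> 'a \<Rightarrow> real" and le :: "'a \<Rightarrow> 'a \<Rightarrow> bool" +
  fixes S :: "'a set"
  assumes achronal: "s \<in> S \<Longrightarrow> s' \<in> S \<Longrightarrow> D s s' = 0"
    and cover: "x \<in> S \<or> (\<exists>s\<in>S. 0 < D s x) \<or> (\<exists>s\<in>S. 0 < D x s)"
    and hits_future: "(\<And>k::nat. 0 < D (y k) (y (Suc k))) \<Longrightarrow> (\<And>u. \<exists>k. \<not> le (y k) u) \<Longrightarrow>
      \<exists>s\<in>S. \<exists>k. le s (y k)"
    and hits_past: "(\<And>k::nat. 0 < D (y (Suc k)) (y k)) \<Longrightarrow> (\<And>u. \<exists>k. \<not> le u (y k)) \<Longrightarrow>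
      \<exists>s\<in>S. \<exists>k. le (y k) s"
    and continuous_dist: "continuous_on UNIV (\<lambda>x. SUP s\<in>S. ereal (D x s + D s x))"
begin

definition set_dist :: "'a \<Rightarrow> ereal" where
  "set_dist x = (SUP s\<in>S. ereal (D x s + D s x))"

lemma reversed_cauchy: "cauchy_structure (\<lambda>x y. D y x) (\<lambda>x y. le y x) S"
proof -
  interpret R: causal_structure "\<lambda>x y. D y x" "\<lambda>x y. le y x" by (rule reversed)
  show ?thesis
  proof
    show "continuous_on UNIV (\<lambda>x. SUP s\<in>S. ereal (D s x + D x s))"
      using continuous_dist by (simp add: add.commute)
  qed (use achronal cover hits_future hits_past in blast)+
qed

text \<open>One direction is push-up with achronality, the other is \<open>cover\<close>. The causal
  future of \<open>S\<close> thereby becomes the complement of its chronological past.\<close>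

lemma after_iff: "(\<exists>s\<in>S. le s x) \<longleftrightarrow> \<not> (\<exists>s\<in>S. 0 < D x s)"
proof
  assume "\<exists>s\<in>S. le s x"
  then show "\<not> (\<exists>s\<in>S. 0 < D x s)"
    using le_D_trans achronal by (metis less_irrefl)
next
  assume "\<not> (\<exists>s\<in>S. 0 < D x s)"
  then show "\<exists>s\<in>S. le s x"
    using cover[of x] le_refl[of x] D_le by blast
qed

text \<open>A union of closed futures over infinitely many points need not be closed; its
  complement, however, is a union of open chronological pasts.\<close>

lemma closed_after: "closed {x. \<exists>s\<in>S. le s x}"
proof -
  have "{x. \<exists>s\<in>S. le s x} = - (\<Union>s\<in>S. {x. 0 < D x s})"
    using after_iff by auto
  then show ?thesis using open_past by (auto simp: closed_Compl)
qed

lemma before_iff: "(\<exists>s\<in>S. le x s) \<longleftrightarrow> \<not> (\<exists>s\<in>S. 0 < D s x)"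
proof -
  interpret R: cauchy_structure "\<lambda>x y. D y x" "\<lambda>x y. le y x" S by (rule reversed_cauchy)
  show ?thesis by (rule R.after_iff)
qed

lemma closed_before: "closed {x. \<exists>s\<in>S. le x s}"
proof -
  interpret R: cauchy_structure "\<lambda>x y. D y x" "\<lambda>x y. le y x" S by (rule reversed_cauchy)
  show ?thesis by (rule R.closed_after)
qed

lemma set_dist_before_finite:
  assumes "\<exists>s\<in>S. le x s"
  shows "set_dist x \<noteq> \<infinity>"
proof -
  obtain s where s: "s \<in> S" "le x s" using assms by blast
  show ?thesis
    unfolding set_dist_def
    by (rule finite_before[OF _ closed_before continuous_dist _ s]) (fact achronal, fact hits_future)
qed

lemma set_dist_after_finite:
  assumes "\<exists>s\<in>S. le s x"
  shows "set_dist x \<noteq> \<infinity>"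
proof -
  interpret R: cauchy_structure "\<lambda>x y. D y x" "\<lambda>x y. le y x" S by (rule reversed_cauchy)
  show ?thesis
    using R.set_dist_before_finite[OF assms] unfolding set_dist_def R.set_dist_def
    by (simp add: add.commute)
qed

lemma before_or_after: "(\<exists>s\<in>S. le s x) \<or> (\<exists>s\<in>S. le x s)"
  using cover[of x] le_refl[of x] D_le by blast

lemma S_nonempty: "S \<noteq> {}"
  using cover by blast

lemma set_dist_upper: "s \<in> S \<Longrightarrow> ereal (D x s + D s x) \<le> set_dist x"
  unfolding set_dist_def by (rule SUP_upper)

lemma set_dist_nonneg: "0 \<le> set_dist x"
proof -
  obtain s where "s \<in> S" using S_nonempty by blast
  then show ?thesis
    using set_dist_upper[of s x] D_nonneg[of x s] D_nonneg[of s x]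
    by (auto intro: order_trans[of _ "ereal (D x s + D s x)"])
qed

lemma set_dist_finite: "\<bar>set_dist x\<bar> \<noteq> \<infinity>"
  using before_or_after set_dist_before_finite set_dist_after_finite set_dist_nonneg[of x] by fastforce

text \<open>A point outside \<open>S\<close> is chronologically related to some point of
  \<open>S\<close> by \<open>cover\<close>, hence has positive distance.\<close>

lemma set_dist_eq_0_iff: "set_dist x = 0 \<longleftrightarrow> x \<in> S"
proof
  assume "set_dist x = 0"
  then have "D x s + D s x \<le> 0" if "s \<in> S" for s using set_dist_upper[OF that, of x] by simp
  then have "D x s \<le> 0" "D s x \<le> 0" if "s \<in> S" for s
    using that D_nonneg[of x s] D_nonneg[of s x] by force+
  then show "x \<in> S" using cover[of x] by force
next
  assume "x \<in> S"
  then have "set_dist x \<le> 0"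
    unfolding set_dist_def using achronal by (intro SUP_least) simp
  then show "set_dist x = 0" using set_dist_nonneg by (simp add: antisym)
qed

lemma before_and_after: "(\<exists>s\<in>S. le s x) \<Longrightarrow> (\<exists>s\<in>S. le x s) \<Longrightarrow> x \<in> S"
  using cover[of x] after_iff[of x] before_iff[of x] by blast

end

section \<open>Lorentzian spaces without boundary\<close>

definition real_dist :: "('a \<Rightarrow> 'a \<Rightarrow> ereal) \<Rightarrow> 'a \<Rightarrow> 'a \<Rightarrow> real" where
  "real_dist l x y = real_of_ereal (lor_dist l x y)"

lemma ereal_real_dist: "finite_lor_dist l \<Longrightarrow> ereal (real_dist l x y) = lor_dist l x y"
proof -
  assume "finite_lor_dist l"
  then have "lor_dist l x y < \<infinity>" by (simp add: finite_lor_dist_def)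
  moreover have "0 \<le> lor_dist l x y" by (simp add: lor_dist_def)
  ultimately show ?thesis unfolding real_dist_def by (intro ereal_real') auto
qed

lemma chron_less_iff: "finite_lor_dist l \<Longrightarrow> chron_less l x y \<longleftrightarrow> 0 < real_dist l x y"
  by (simp add: chron_less_def flip: ereal_real_dist)

text \<open>The partition \<open>a\<close>, \<open>c\<close>, \<open>b\<close> bounds the length
  from above by the sum of the two distances; the reverse triangle inequality gives the other
  estimate.\<close>

lemma geodesic_additive:
  assumes triangle: "\<And>x y z. causal_le l x y \<Longrightarrow> causal_le l y z \<Longrightarrow>
      lor_dist l x y + lor_dist l y z \<le> lor_dist l x z"
    and \<gamma>: "causal_curve cv l {a..b} \<gamma>" "lor_length l a b \<gamma> = lor_dist l (\<gamma> a) (\<gamma> b)"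
    and c: "a < c" "c < b"
  shows "lor_dist l (\<gamma> a) (\<gamma> c) + lor_dist l (\<gamma> c) (\<gamma> b) = lor_dist l (\<gamma> a) (\<gamma> b)"
proof (rule antisym)
  show "lor_dist l (\<gamma> a) (\<gamma> c) + lor_dist l (\<gamma> c) (\<gamma> b) \<le> lor_dist l (\<gamma> a) (\<gamma> b)"
    using \<gamma>(1) c by (intro triangle) (auto simp: causal_curve_def)
  define t where "t i = (if i = 0 then a else if i = 1 then c else b)" for i :: nat
  have "partition_of a b 2 t"
    using c by (auto simp: partition_of_def t_def less_2_cases_iff)
  then have "lor_length l a b \<gamma> \<le> (\<Sum>i<2. lor_dist l (\<gamma> (t i)) (\<gamma> (t (Suc i))))"
    unfolding lor_length_def by (intro Inf_lower) blast
  also have "\<dots> = lor_dist l (\<gamma> a) (\<gamma> c) + lor_dist l (\<gamma> c) (\<gamma> b)"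
    by (simp add: t_def numeral_2_eq_2)
  finally show "lor_dist l (\<gamma> a) (\<gamma> b) \<le> lor_dist l (\<gamma> a) (\<gamma> c) + lor_dist l (\<gamma> c) (\<gamma> b)"
    using \<gamma>(2) by simp
qed

lemma continuous_real_of_ereal:
  assumes "continuous_on A f" "\<And>x. x \<in> A \<Longrightarrow> \<bar>f x\<bar> \<noteq> \<infinity>"
  shows "continuous_on A (\<lambda>x. real_of_ereal (f x))"
proof -
  have "f ` A \<subseteq> UNIV - {\<infinity>, - \<infinity>}" using assms(2) by fastforce
  then show ?thesis by (rule continuous_on_compose2[OF continuous_on_real assms(1)])
qed

text \<open>The two settings of the theorem are treated together here: they differ only in the class
  \<open>cv\<close>, of which the gluing properties are kept.\<close>

locale complete_lorentzian_space = gluing_curve_class cv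
  for cv :: "'a::topological_space curve_class" +
  fixes l :: "'a \<Rightarrow> 'a \<Rightarrow> ereal" and S :: "'a set"
  assumes separation: "extended_time_separation l"
    and causally_simple: "causally_simple l"
    and tl_connected: "timelike_path_connected cv l"
    and geodesic: "geodesic_space cv l"
    and finite: "finite_lor_dist l"
    and continuous_lor: "continuous_lor_dist l"
    and diamonds: "compact_causal_diamonds l"
    and cond_B: "condition_B cv l"
    and no_bdry: "chron_bdry l = {}"
    and cauchy: "cauchy_set cv l S"
    and continuous_dJ: "continuous_on UNIV (dJ_pt l S)"
begin

abbreviation "D \<equiv> real_dist l"

lemma ereal_D: "ereal (D x y) = lor_dist l x y"
  using finite by (rule ereal_real_dist)

lemma nonneg_D: "0 \<le> D x y"
proof -
  have "0 \<le> ereal (D x y)" by (simp add: ereal_D lor_dist_def)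
  then show ?thesis by simp
qed

lemma chron_iff: "chron_less l x y \<longleftrightarrow> 0 < D x y"
  using finite by (rule chron_less_iff)

lemma dJ_pt_eq_SUP: "dJ_pt l S x = (SUP s\<in>S. ereal (D x s + D s x))"
proof -
  have "{x} \<times> S = Pair x ` S" by auto
  then show ?thesis
    unfolding dJ_pt_def dJ_def by (simp add: image_image flip: ereal_D)
qed

lemma triangle:
  assumes "causal_le l x y" "causal_le l y z"
  shows "lor_dist l x y + lor_dist l y z \<le> lor_dist l x z" "causal_le l x z"
proof -
  have nonneg: "0 \<le> l x y" "0 \<le> l y z" using assms by (auto simp: causal_le_def)
  then have "l x y + l y z \<le> l x z"
    using separation unfolding extended_time_separation_def by force
  moreover have "0 \<le> l x y + l y z" using nonneg by simp
  ultimately have "0 \<le> l x z" by (rule order_trans[rotated])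
  then show "causal_le l x z" by (simp add: causal_le_def)
  show "lor_dist l x y + lor_dist l y z \<le> lor_dist l x z"
    using nonneg \<open>0 \<le> l x z\<close> \<open>l x y + l y z \<le> l x z\<close> by (simp add: lor_dist_def max_absorb2)
qed

lemma chron_imp_causal: "chron_less l x y \<Longrightarrow> causal_le l x y"
  unfolding chron_less_def causal_le_def lor_dist_def by (simp add: less_max_iff_disj)

lemma continuous_D:
  "continuous_on UNIV (D x)" "continuous_on UNIV (\<lambda>x. D x y)"
proof -
  have cont: "continuous_on UNIV (\<lambda>p. lor_dist l (fst p) (snd p))"
    using continuous_lor by (simp add: continuous_lor_dist_def case_prod_beta')
  have fin: "\<bar>lor_dist l x y\<bar> \<noteq> \<infinity>" for x y
    by (simp flip: ereal_D)
  have "continuous_on UNIV (\<lambda>y. lor_dist l (fst (x, y)) (snd (x, y)))"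
    by (rule continuous_on_compose2[OF cont]) (auto intro!: continuous_intros)
  then show "continuous_on UNIV (D x)"
    unfolding real_dist_def[abs_def] using fin by (intro continuous_real_of_ereal) auto
  have "continuous_on UNIV (\<lambda>x. lor_dist l (fst (x, y)) (snd (x, y)))"
    by (rule continuous_on_compose2[OF cont]) (auto intro!: continuous_intros)
  then show "continuous_on UNIV (\<lambda>x. D x y)"
    unfolding real_dist_def[abs_def] using fin by (intro continuous_real_of_ereal) auto
qed

sublocale timelike_connected cv l
proof
  show "chron_less l x z" if "chron_less l x y" "chron_less l y z" for x y z
  proof -
    have "D x y + D y z \<le> D x z"
      using triangle(1)[of x y z] chron_imp_causal that by (simp flip: ereal_D)
    then show ?thesis using that by (simp add: chron_iff)
  qed
  show "causal_le l x z" if "causal_le l x y" "causal_le l y z" for x y z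
    using that by (rule triangle(2))
  show "causal_le l x x" for x
    using separation by (simp add: extended_time_separation_def causal_le_def)
qed (rule chron_imp_causal tl_connected, assumption?)+

sublocale causal_structure D "causal_le l"
proof
  fix x y z
  show "0 \<le> D x y"
    by (rule nonneg_D)
  show "causal_le l x y" if "0 < D x y" using that chron_iff chron_causal by blast
  show "causal_le l x x" by (rule causal_refl)
  show "causal_le l x z" if "causal_le l x y" "causal_le l y z" using that by (rule causal_trans)
  show "x = y" if "causal_le l x y" "causal_le l y x"
    using that causally_simple by (auto simp: causally_simple_def)
  show "D x y + D y z \<le> D x z" if "causal_le l x y" "causal_le l y z"
    using triangle(1)[OF that] by (simp flip: ereal_D)
  show "closed {y. causal_le l x y}" "closed {y. causal_le l y x}"
    using causally_simple by (auto simp: causally_simple_def J_plus_def J_minus_def)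
  show "compact {y. causal_le l x y \<and> causal_le l y z}"
    using diamonds by (auto simp: compact_causal_diamonds_def J_plus_def J_minus_def Collect_conj_eq)
  show "continuous_on UNIV (D x)" "continuous_on UNIV (\<lambda>x. D x y)" by (rule continuous_D)+
  \<comment> \<open>This is where the emptiness of the chronological boundary enters.\<close>
  show "\<exists>y. 0 < D x y" "\<exists>y. 0 < D y x"
    using no_bdry unfolding chron_iff[symmetric]
    by (auto simp: chron_bdry_def chron_bdry_plus_def chron_bdry_minus_def I_plus_def I_minus_def)
  show "\<exists>\<sigma>. continuous_on {0..1::real} \<sigma> \<and> \<sigma> 0 = x \<and> \<sigma> 1 = y \<and>
      (\<forall>s t. 0 \<le> s \<longrightarrow> s < t \<longrightarrow> t \<le> 1 \<longrightarrow> 0 < D (\<sigma> s) (\<sigma> t))" if "0 < D x y"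
  proof -
    obtain \<sigma> where \<sigma>: "timelike_curve cv l {0..1} \<sigma>" "\<sigma> 0 = x" "\<sigma> 1 = y"
      using timelike_unit_path \<open>0 < D x y\<close> chron_iff by blast
    have "continuous_on {0..1} \<sigma>"
      using \<sigma>(1) continuous unfolding timelike_curve_def by blast
    then show ?thesis
      using \<sigma> by (intro exI[of _ \<sigma>]) (auto simp: timelike_curve_def chron_iff)
  qed
  show "\<exists>\<sigma>. continuous_on {0..1::real} \<sigma> \<and> \<sigma> 0 = x \<and> \<sigma> 1 = y \<and>
      (\<forall>t. 0 \<le> t \<longrightarrow> t \<le> 1 \<longrightarrow> causal_le l x (\<sigma> t) \<and> causal_le l (\<sigma> t) y \<and>
        D x (\<sigma> t) + D (\<sigma> t) y = D x y)" if "causal_le l x y"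
  proof -
    obtain a b \<gamma> where ab: "a < b" and \<gamma>: "causal_curve cv l {a..b} \<gamma>" "\<gamma> a = x" "\<gamma> b = y"
      "lor_length l a b \<gamma> = lor_dist l x y"
      using geodesic \<open>causal_le l x y\<close> unfolding geodesic_space_def by blast
    \<comment> \<open>At the endpoints of the geodesic one of the two summands is such a
      distance.\<close>
    have self: "D v v = 0" for v
    proof -
      have "D v v + D v v \<le> D v v"
        using triangle(1)[OF causal_refl causal_refl, of v] by (simp flip: ereal_D)
      moreover have "0 \<le> D v v" by (rule nonneg_D)
      ultimately show ?thesis by simp
    qed
    have between: "causal_le l x (\<gamma> c) \<and> causal_le l (\<gamma> c) y \<and> D x (\<gamma> c) + D (\<gamma> c) y = D x y"
      if c: "a \<le> c" "c \<le> b" for c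
    proof -
      consider "c = a" | "c = b" | "a < c" "c < b" using c by linarith
      then show ?thesis
      proof cases
        case 3
        then have "causal_le l x (\<gamma> c)" "causal_le l (\<gamma> c) y"
          using \<gamma> unfolding causal_curve_def by auto
        moreover have "lor_dist l x (\<gamma> c) + lor_dist l (\<gamma> c) y = lor_dist l x y"
          using geodesic_additive[OF triangle(1) \<gamma>(1)] 3 \<gamma>(2-4) by simp
        ultimately show ?thesis by (simp flip: ereal_D)
      qed (use \<gamma>(2,3) self causal_refl \<open>causal_le l x y\<close> in auto)
    qed
    have img: "a \<le> a + (b - a) * t \<and> a + (b - a) * t \<le> b" if "0 \<le> t" "t \<le> 1" for t
    proof -
      have "(b - a) * t \<le> (b - a) * 1" "0 \<le> (b - a) * t"
        using that ab by (auto intro!: mult_left_mono)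
      then show ?thesis by simp
    qed
    have "continuous_on {a..b} \<gamma>" using \<gamma>(1) continuous unfolding causal_curve_def by blast
    moreover have "continuous_on {0..1} (\<lambda>t. a + (b - a) * t)" by (intro continuous_intros)
    moreover have "(\<lambda>t. a + (b - a) * t) ` {0..1} \<subseteq> {a..b}" using img by auto
    ultimately have "continuous_on {0..1} (\<lambda>t. \<gamma> (a + (b - a) * t))"
      by (rule continuous_on_compose2)
    then show ?thesis
      using \<gamma>(2,3) img between by (intro exI[of _ "\<lambda>t. \<gamma> (a + (b - a) * t)"]) auto
  qed
qed

section \<open>Inextendible timelike curves through given points and the Cauchy set\<close>

lemma future_seq:
  obtains f where "f 0 = x" "\<And>k. chron_less l (f k) (f (Suc k))" "\<And>u. \<exists>k. \<not> causal_le l (f k) u"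
proof -
  obtain w where "0 < D x w" using ex_future by blast
  then have "\<exists>y. y 0 = x \<and> (\<forall>k. 0 < D (y k) (y (Suc k))) \<and> (\<forall>k. y k \<in> UNIV) \<and>
      (\<forall>u. \<exists>k. \<not> causal_le l (y k) u)"
  \<comment> \<open>With \<open>F\<close> the whole space, the next point can be any chronological
    successor, which is distinct because \<open>D z z = 0\<close>.\<close>
  proof (rule unbounded_timelike_seq[rotated 4])
    fix z
    obtain w where "0 < D z w" using ex_future by blast
    then show "\<exists>w\<in>UNIV. causal_le l z w \<and> z \<noteq> w"
      using D_le[of z w] D_self[of z] by (intro bexI[of _ w]) auto
  qed auto
  then show ?thesis using that chron_iff by blast
qed

lemma past_seq:
  obtains g where "g 0 = x" "\<And>k. chron_less l (g (Suc k)) (g k)" "\<And>u. \<exists>k. \<not> causal_le l u (g k)"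
proof -
  interpret R: causal_structure "\<lambda>x y. D y x" "\<lambda>x y. causal_le l y x" by (rule reversed)
  obtain w where "0 < D w x" using ex_past by blast
  then have "\<exists>y. y 0 = x \<and> (\<forall>k. 0 < D (y (Suc k)) (y k)) \<and> (\<forall>k. y k \<in> UNIV) \<and>
      (\<forall>u. \<exists>k. \<not> causal_le l u (y k))"
  proof (rule R.unbounded_timelike_seq[rotated 4])
    fix z
    obtain w where "0 < D w z" using ex_past by blast
    then show "\<exists>w\<in>UNIV. causal_le l w z \<and> z \<noteq> w"
      using D_le[of w z] D_self[of z] by (intro bexI[of _ w]) auto
  qed auto
  then show ?thesis using that chron_iff by blast
qed

lemma curve_meets:
  assumes "inext_timelike_curve cv l I \<gamma>"
  obtains t where "t \<in> I" "\<gamma> t \<in> S" "\<And>t'. t' \<in> I \<Longrightarrow> \<gamma> t' \<in> S \<Longrightarrow> t' = t"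
  using cauchy assms unfolding cauchy_set_def by blast

lemma inext_curve_mono:
  assumes "inext_timelike_curve cv l I \<gamma>" "t \<in> I" "s \<in> I" "t \<le> s"
  shows "causal_le l (\<gamma> t) (\<gamma> s)" "t < s \<Longrightarrow> 0 < D (\<gamma> t) (\<gamma> s)"
proof -
  have tl: "t < s \<Longrightarrow> chron_less l (\<gamma> t) (\<gamma> s)"
    using assms(1-3) unfolding inext_timelike_curve_def timelike_curve_def by blast
  then show "t < s \<Longrightarrow> 0 < D (\<gamma> t) (\<gamma> s)" by (simp add: chron_iff)
  show "causal_le l (\<gamma> t) (\<gamma> s)"
    using tl chron_causal causal_refl \<open>t \<le> s\<close> by (cases "t = s") auto
qed

text \<open>The order-theoretic axioms all come from running an inextendible timelike curve through
  suitable points and using that it meets \<open>S\<close> exactly once.\<close>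

sublocale cauchy_structure D "causal_le l" S
proof
  show hits_future: "\<exists>s\<in>S. \<exists>k. causal_le l s (y k)"
    if y: "\<And>k. 0 < D (y k) (y (Suc k))" "\<And>u. \<exists>k. \<not> causal_le l (y k) u" for y :: "nat \<Rightarrow> 'a"
  proof -
    \<comment> \<open>A past sequence from \<open>y 0\<close> completes \<open>y\<close> to a curve
      inextendible in both directions; its crossing with \<open>S\<close> precedes some
      \<open>y k\<close>.\<close>
    obtain g where g: "g 0 = y 0" "\<And>k. chron_less l (g (Suc k)) (g k)"
      "\<And>u. \<exists>k. \<not> causal_le l u (g k)"
      using past_seq[of "y 0"] by blast
    obtain \<gamma> where \<gamma>: "inext_timelike_curve cv l UNIV \<gamma>" "\<And>k. \<gamma> (real k) = y k"
      using inextendible_curve_through[OF y[folded chron_iff] g(2,3)] g(1) by auto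
    obtain t where "\<gamma> t \<in> S" using curve_meets[OF \<gamma>(1)] by blast
    moreover obtain k where "t \<le> real k" using real_arch_simple by blast
    ultimately show ?thesis
      using inext_curve_mono(1)[OF \<gamma>(1), of t "real k"] \<gamma>(2) by (intro bexI[of _ "\<gamma> t"]) auto
  qed
  show "D s s' = 0" if ss: "s \<in> S" "s' \<in> S" for s s'
  proof (rule ccontr)
    assume "D s s' \<noteq> 0"
    then have "0 < D s s'" using D_nonneg[of s s'] by simp
    obtain f where f: "f 0 = s'" "\<And>k. chron_less l (f k) (f (Suc k))"
      "\<And>u. \<exists>k. \<not> causal_le l (f k) u"
      using future_seq[of "s'"] by blast
    obtain g where g: "g 0 = s" "\<And>k. chron_less l (g (Suc k)) (g k)"
      "\<And>u. \<exists>k. \<not> causal_le l u (g k)"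
      using past_seq[of "s"] by blast
    \<comment> \<open>Prepending \<open>s\<close> to the sequence from \<open>s'\<close> makes the
      curve meet \<open>S\<close> at time 0 in \<open>s\<close> and at time 1 in \<open>s'\<close>,
      contrary to uniqueness.\<close>
    define h where "h k = (case k of 0 \<Rightarrow> s | Suc j \<Rightarrow> f j)" for k
    have h1: "chron_less l (h k) (h (Suc k))" for k
      using f(1,2) \<open>0 < D s s'\<close> chron_iff by (auto simp: h_def split: nat.split)
    have h2: "\<exists>k. \<not> causal_le l (h k) u" for u
    proof -
      obtain k where "\<not> causal_le l (f k) u" using f(3) by blast
      then show ?thesis by (intro exI[of _ "Suc k"]) (simp add: h_def)
    qed
    have "h 0 = g 0" by (simp add: h_def g(1))
    then obtain \<gamma> where \<gamma>: "inext_timelike_curve cv l UNIV \<gamma>" "\<And>k. \<gamma> (real k) = h k"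
      using inextendible_curve_through[OF h1 h2 g(2,3)] by blast
    have "\<gamma> 0 \<in> S" "\<gamma> 1 \<in> S"
      using \<gamma>(2)[of 0] \<gamma>(2)[of 1] ss f(1) by (auto simp: h_def)
    then show False using curve_meets[OF \<gamma>(1)] by (metis UNIV_I zero_neq_one)
  qed
  show "x \<in> S \<or> (\<exists>s\<in>S. 0 < D s x) \<or> (\<exists>s\<in>S. 0 < D x s)" for x
  proof -
    obtain f where f: "f 0 = x" "\<And>k. chron_less l (f k) (f (Suc k))"
      "\<And>u. \<exists>k. \<not> causal_le l (f k) u"
      using future_seq[of "x"] by blast
    obtain g where g: "g 0 = x" "\<And>k. chron_less l (g (Suc k)) (g k)"
      "\<And>u. \<exists>k. \<not> causal_le l u (g k)"
      using past_seq[of "x"] by blast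
    obtain \<gamma> where \<gamma>: "inext_timelike_curve cv l UNIV \<gamma>" "\<And>k. \<gamma> (real k) = f k"
      using inextendible_curve_through[OF f(2,3) g(2,3)] f(1) g(1) by auto
    have "\<gamma> 0 = x" using \<gamma>(2)[of 0] f(1) by simp
    moreover obtain t where "\<gamma> t \<in> S" using curve_meets[OF \<gamma>(1)] by blast
    ultimately show ?thesis
      using inext_curve_mono(2)[OF \<gamma>(1), of t 0] inext_curve_mono(2)[OF \<gamma>(1), of 0 t]
      by (cases t "0::real" rule: linorder_cases) auto
  qed
  show "\<exists>s\<in>S. \<exists>k. causal_le l (y k) s"
    if y: "\<And>k. 0 < D (y (Suc k)) (y k)" "\<And>u. \<exists>k. \<not> causal_le l u (y k)" for y :: "nat \<Rightarrow> 'a"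
  proof -
    obtain f where f: "f 0 = y 0" "\<And>k. chron_less l (f k) (f (Suc k))"
      "\<And>u. \<exists>k. \<not> causal_le l (f k) u"
      using future_seq[of "y 0"] by blast
    obtain \<gamma> where \<gamma>: "inext_timelike_curve cv l UNIV \<gamma>" "\<And>k. \<gamma> (- real k) = y k"
      using inextendible_curve_through[OF f(2,3) y[folded chron_iff]] f(1) by auto
    obtain t where "\<gamma> t \<in> S" using curve_meets[OF \<gamma>(1)] by blast
    moreover obtain k where "- t \<le> real k" using real_arch_simple by blast
    ultimately show ?thesis
      using inext_curve_mono(1)[OF \<gamma>(1), of "- real k" t] \<gamma>(2) by (intro bexI[of _ "\<gamma> t"]) auto
  qed
  show "continuous_on UNIV (\<lambda>x. SUP s\<in>S. ereal (D x s + D s x))"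
    using continuous_dJ by (simp add: dJ_pt_eq_SUP[abs_def])
qed

end

section \<open>The function \<open>\<tau>\<close>\<close>

context complete_lorentzian_space
begin

lemma dJ_pt_eq: "dJ_pt l S = set_dist"
  by (simp add: fun_eq_iff dJ_pt_eq_SUP set_dist_def)

lemma J_plus_set_iff: "x \<in> J_plus_set l S \<longleftrightarrow> (\<exists>s\<in>S. causal_le l s x)"
  by (auto simp: J_plus_set_def J_plus_def)

lemma J_minus_set_iff: "x \<in> J_minus_set l S \<longleftrightarrow> (\<exists>s\<in>S. causal_le l x s)"
  by (auto simp: J_minus_set_def J_minus_def)

lemma tau_well_defined: "tau_well_defined l S"
  unfolding tau_well_defined_def dJ_pt_eq
proof (intro conjI ballI allI)
  show "J_plus_set l S \<union> J_minus_set l S = UNIV"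
    using before_or_after J_plus_set_iff J_minus_set_iff by blast
  show "\<bar>set_dist x\<bar> \<noteq> \<infinity>" for x by (rule set_dist_finite)
  fix x assume "x \<in> J_plus_set l S \<inter> J_minus_set l S"
  then have "set_dist x = 0"
    using before_and_after set_dist_eq_0_iff by (auto simp: J_plus_set_iff J_minus_set_iff)
  then show "set_dist x = - set_dist x" by simp
qed

lemma ereal_set_dist: "ereal (real_of_ereal (set_dist x)) = set_dist x"
  using set_dist_finite by (rule ereal_real')

lemma tau_after: "\<exists>s\<in>S. causal_le l s x \<Longrightarrow> tau l S x = real_of_ereal (set_dist x)"
  by (simp add: tau_def dJ_pt_eq J_plus_set_iff)

lemma tau_before:
  assumes "\<exists>s\<in>S. causal_le l x s"
  shows "tau l S x = - real_of_ereal (set_dist x)"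
proof (cases "\<exists>s\<in>S. causal_le l s x")
  \<comment> \<open>On the overlap \<open>tau\<close> takes its value from the first case; both
    values vanish there.\<close>
  case True
  then have "set_dist x = 0" using assms before_and_after set_dist_eq_0_iff by blast
  then show ?thesis using tau_after[OF True] by simp
next
  case False
  then show ?thesis using assms by (simp add: tau_def dJ_pt_eq J_plus_set_iff J_minus_set_iff)
qed

text \<open>The causal future and past of \<open>S\<close> are closed and cover the space. On them
  \<open>tau\<close> is the distance and its negative, so closed pasting applies.\<close>

lemma continuous_tau: "continuous_on UNIV (tau l S)"
proof -
  have cont: "continuous_on A (\<lambda>x. real_of_ereal (set_dist x))" for A
    using continuous_dJ set_dist_finite unfolding dJ_pt_eq
    by (intro continuous_real_of_ereal continuous_on_subset[of UNIV set_dist A]) auto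
  have "continuous_on ({x. \<exists>s\<in>S. causal_le l s x} \<union> {x. \<exists>s\<in>S. causal_le l x s}) (tau l S)"
  proof (rule continuous_on_closed_Un[OF closed_after closed_before])
    show "continuous_on {x. \<exists>s\<in>S. causal_le l s x} (tau l S)"
      using cont by (rule continuous_on_eq) (simp add: tau_after)
    show "continuous_on {x. \<exists>s\<in>S. causal_le l x s} (tau l S)"
      using continuous_on_minus[OF cont] by (rule continuous_on_eq) (simp add: tau_before)
  qed
  moreover have "{x. \<exists>s\<in>S. causal_le l s x} \<union> {x. \<exists>s\<in>S. causal_le l x s} = UNIV"
    using before_or_after by blast
  ultimately show ?thesis by simp
qed

text \<open>The boundary parts of \<open>parallel_set\<close> are empty. As the distance is
  nonnegative, the sign of \<open>tau\<close> identifies the side of \<open>S\<close>, and its zeros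
  are the points of \<open>S\<close>.\<close>

lemma tau_level_set: "tau l S -` {t} = parallel_set l S t"
proof -
  have bdry: "chron_bdry_plus l = {}" "chron_bdry_minus l = {}"
    using no_bdry by (auto simp: chron_bdry_def)
  have nonneg: "0 \<le> real_of_ereal (set_dist x)" for x
    using set_dist_nonneg by (simp add: real_of_ereal_pos)
  have dist_iff: "set_dist x = ereal r \<longleftrightarrow> real_of_ereal (set_dist x) = r" for x r
    using ereal_set_dist[of x] by auto
  consider "t = 0" | "0 < t" | "t < 0" by linarith
  then show ?thesis
  proof cases
    case 1
    have "tau l S x = 0 \<longleftrightarrow> x \<in> S" for x
    proof -
      have "tau l S x = 0 \<longleftrightarrow> real_of_ereal (set_dist x) = 0"
        using before_or_after[of x] tau_after[of x] tau_before[of x] by linarith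
      also have "\<dots> \<longleftrightarrow> set_dist x = 0"
        using dist_iff[of x 0] by (simp add: zero_ereal_def)
      finally show ?thesis by (simp only: set_dist_eq_0_iff)
    qed
    then show ?thesis using 1 by (auto simp: parallel_set_def)
  next
    case 2
    have "tau l S x = t \<longleftrightarrow> (\<exists>s\<in>S. causal_le l s x) \<and> set_dist x = ereal t" for x
    proof (cases "\<exists>s\<in>S. causal_le l s x")
      case True
      then show ?thesis using tau_after[OF True] by (simp only: dist_iff simp_thms)
    next
      case False
      then have "\<exists>s\<in>S. causal_le l x s" using before_or_after by blast
      then show ?thesis using False tau_before[of x] nonneg[of x] 2 by linarith
    qed
    then show ?thesis using 2 by (auto simp: parallel_set_def bdry dJ_pt_eq J_plus_set_iff)
  next
    case 3
    have "tau l S x = t \<longleftrightarrow> (\<exists>s\<in>S. causal_le l x s) \<and> set_dist x = ereal (- t)" for x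
    proof (cases "\<exists>s\<in>S. causal_le l x s")
      case True
      then show ?thesis using tau_before[OF True] dist_iff[of x "- t"] by linarith
    next
      case False
      then have "\<exists>s\<in>S. causal_le l s x" using before_or_after by blast
      then show ?thesis using False tau_after[of x] nonneg[of x] 3 by linarith
    qed
    then show ?thesis using 3 by (auto simp: parallel_set_def bdry dJ_pt_eq J_minus_set_iff)
  qed
qed

section \<open>Divergence of \<open>tau\<close> along inextendible timelike curves\<close>

lemma D_le_set_dist: "s \<in> S \<Longrightarrow> D x s + D s x \<le> real_of_ereal (set_dist x)"
  using set_dist_upper[of s x] ereal_set_dist[of x] by (metis ereal_less_eq(3))

lemma D_le_tau:
  assumes "s \<in> S" "causal_le l s x"
  shows "D s x \<le> tau l S x"
  using D_le_set_dist[OF assms(1), of x] tau_after[of x] assms D_nonneg[of x s] by force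

lemma tau_le_minus_D:
  assumes "s \<in> S" "causal_le l x s"
  shows "tau l S x \<le> - D x s"
  using D_le_set_dist[OF assms(1), of x] tau_before[of x] assms D_nonneg[of s x] by force

text \<open>
  If the distance along the curve were bounded, Condition B would give \<open>sup I \<in> I\<close>, and the curve
  could be extended beyond this endpoint because the future boundary is empty.
\<close>

lemma future_unbounded:
  assumes \<gamma>: "inext_timelike_curve cv l I \<gamma>" and "t0 \<in> I"
  shows "\<exists>t\<in>I. t0 \<le> t \<and> r < D (\<gamma> t0) (\<gamma> t)"
proof (rule ccontr)
  assume "\<not> ?thesis"
  then have "\<forall>t\<in>{t0..} \<inter> I. lor_dist l (\<gamma> t0) (\<gamma> t) \<le> ereal r"
    by (auto simp: not_less simp flip: ereal_D)
  then have "Sup (ereal ` I) \<in> ereal ` I"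
    using cond_B \<gamma> \<open>t0 \<in> I\<close>
    unfolding condition_B_def future_inext_timelike_curve_def inext_timelike_curve_def by blast
  then obtain b where b: "b \<in> I" "Sup (ereal ` I) = ereal b" by blast
  have "t \<le> b" if "t \<in> I" for t
    using Sup_upper[of "ereal t" "ereal ` I"] that b(2) by simp
  then have "I \<subseteq> {..b}" by blast
  moreover obtain q where "chron_less l (\<gamma> b) q" using ex_future chron_iff by blast
  ultimately have "future_extendible cv l I \<gamma>"
    using \<gamma> b(1) by (intro future_extendible_at_max) (auto simp: inext_timelike_curve_def)
  then show False using \<gamma> by (simp add: inext_timelike_curve_def)
qed

text \<open>Time dual: Condition B now gives \<open>inf I \<in> I\<close>, and the empty past
  boundary lets the curve be extended below this endpoint.\<close>

lemma past_unbounded: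
  assumes \<gamma>: "inext_timelike_curve cv l I \<gamma>" and "t0 \<in> I"
  shows "\<exists>t\<in>I. t \<le> t0 \<and> r < D (\<gamma> t) (\<gamma> t0)"
proof (rule ccontr)
  assume "\<not> ?thesis"
  then have "\<forall>t\<in>{..t0} \<inter> I. lor_dist l (\<gamma> t) (\<gamma> t0) \<le> ereal r"
    by (auto simp: not_less simp flip: ereal_D)
  then have "Inf (ereal ` I) \<in> ereal ` I"
    using cond_B \<gamma> \<open>t0 \<in> I\<close>
    unfolding condition_B_def past_inext_timelike_curve_def inext_timelike_curve_def by blast
  then obtain b where b: "b \<in> I" "Inf (ereal ` I) = ereal b" by blast
  have "b \<le> t" if "t \<in> I" for t
    using Inf_lower[of "ereal t" "ereal ` I"] that b(2) by simp
  then have "I \<subseteq> {b..}" by blast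
  moreover obtain q where "chron_less l q (\<gamma> b)" using ex_past chron_iff by blast
  ultimately have "past_extendible cv l I \<gamma>"
    using \<gamma> b(1) by (intro past_extendible_at_min) (auto simp: inext_timelike_curve_def)
  then show False using \<gamma> by (simp add: inext_timelike_curve_def)
qed

lemma inext_curve_between:
  "inext_timelike_curve cv l I \<gamma> \<Longrightarrow> r \<in> I \<Longrightarrow> t \<in> I \<Longrightarrow> r < s \<Longrightarrow> s < t \<Longrightarrow> s \<in> I"
  using is_interval[of I \<gamma>] unfolding inext_timelike_curve_def timelike_curve_def is_interval_1
  by (meson less_imp_le)

text \<open>After the crossing point \<open>\<gamma> t0\<close> with \<open>S\<close>, the monotone
  and unbounded function \<open>D (\<gamma> t0) (\<gamma> t)\<close> bounds \<open>tau\<close> from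
  below.\<close>

lemma tau_tendsto_future:
  assumes \<gamma>: "inext_timelike_curve cv l I \<gamma>"
  shows "filterlim (tau l S \<circ> \<gamma> \<circ> real_of_ereal) at_top (at_left (Sup (ereal ` I)))"
  unfolding filterlim_at_top
proof
  fix Z
  obtain t0 where t0: "t0 \<in> I" "\<gamma> t0 \<in> S" using curve_meets[OF \<gamma>] by blast
  obtain t1 where t1: "t1 \<in> I" "t0 \<le> t1" "Z < D (\<gamma> t0) (\<gamma> t1)"
    using future_unbounded[OF \<gamma> t0(1)] by blast
  \<comment> \<open>The larger distance at \<open>t2\<close> forces \<open>t1 < t2\<close>, so
    \<open>t1\<close> is strictly below the supremum and bounds a genuine left
    neighbourhood.\<close>
  obtain t2 where t2: "t2 \<in> I" "D (\<gamma> t0) (\<gamma> t1) < D (\<gamma> t0) (\<gamma> t2)"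
    using future_unbounded[OF \<gamma> t0(1)] by blast
  have "t1 < t2"
    using D_mono_right[OF inext_curve_mono(1)[OF \<gamma> t2(1) t1(1)], of "\<gamma> t0"] t2(2) by linarith
  then have less: "ereal t1 < Sup (ereal ` I)"
    using t2(1) by (intro less_le_trans[OF _ Sup_upper[of "ereal t2"]]) auto
  have "Z \<le> (tau l S \<circ> \<gamma> \<circ> real_of_ereal) z"
    if z: "ereal t1 < z" "z < Sup (ereal ` I)" for z
  proof -
    \<comment> \<open>Although the limit is taken in the extended reals, \<open>z\<close> lies
      between two parameters of the curve, hence is a real number in \<open>I\<close>.\<close>
    obtain t where t: "t \<in> I" "z < ereal t" using z(2) by (auto simp: less_Sup_iff)
    then obtain r where r: "z = ereal r" "t1 < r" "r < t" using z(1) by (cases z) auto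
    then have "r \<in> I" using inext_curve_between[OF \<gamma> t1(1) t(1)] by blast
    have "Z \<le> D (\<gamma> t0) (\<gamma> r)"
      using D_mono_right[OF inext_curve_mono(1)[OF \<gamma> t1(1) \<open>r \<in> I\<close>], of "\<gamma> t0"] t1(3) r(2)
      by linarith
    also have "\<dots> \<le> tau l S (\<gamma> r)"
      using t0 t1(2) r(2) by (intro D_le_tau inext_curve_mono(1)[OF \<gamma> t0(1) \<open>r \<in> I\<close>]) auto
    finally show ?thesis by (simp add: r(1))
  qed
  then show "eventually (\<lambda>z. Z \<le> (tau l S \<circ> \<gamma> \<circ> real_of_ereal) z) (at_left (Sup (ereal ` I)))"
    unfolding eventually_at_left[OF less] using less by blast
qed

text \<open>Time dual: before the crossing point, \<open>- D (\<gamma> t) (\<gamma> t0)\<close>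
  bounds \<open>tau\<close> from above.\<close>

lemma tau_tendsto_past:
  assumes \<gamma>: "inext_timelike_curve cv l I \<gamma>"
  shows "filterlim (tau l S \<circ> \<gamma> \<circ> real_of_ereal) at_bot (at_right (Inf (ereal ` I)))"
  unfolding filterlim_at_bot
proof
  fix Z
  obtain t0 where t0: "t0 \<in> I" "\<gamma> t0 \<in> S" using curve_meets[OF \<gamma>] by blast
  obtain t1 where t1: "t1 \<in> I" "t1 \<le> t0" "- Z < D (\<gamma> t1) (\<gamma> t0)"
    using past_unbounded[OF \<gamma> t0(1)] by blast
  obtain t2 where t2: "t2 \<in> I" "D (\<gamma> t1) (\<gamma> t0) < D (\<gamma> t2) (\<gamma> t0)"
    using past_unbounded[OF \<gamma> t0(1)] by blast
  have "t2 < t1"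
    using D_mono_left[OF inext_curve_mono(1)[OF \<gamma> t1(1) t2(1)], of "\<gamma> t0"] t2(2) by linarith
  then have less: "Inf (ereal ` I) < ereal t1"
    using t2(1) by (intro le_less_trans[OF Inf_lower[of "ereal t2"]]) auto
  have "(tau l S \<circ> \<gamma> \<circ> real_of_ereal) z \<le> Z"
    if z: "Inf (ereal ` I) < z" "z < ereal t1" for z
  proof -
    obtain t where t: "t \<in> I" "ereal t < z" using z(1) by (auto simp: Inf_less_iff)
    then obtain r where r: "z = ereal r" "t < r" "r < t1" using z(2) by (cases z) auto
    then have "r \<in> I" using inext_curve_between[OF \<gamma> t(1) t1(1)] by blast
    have "tau l S (\<gamma> r) \<le> - D (\<gamma> r) (\<gamma> t0)"
      using t0 t1(2) r(3)
      by (intro tau_le_minus_D inext_curve_mono(1)[OF \<gamma> \<open>r \<in> I\<close> t0(1)]) auto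
    also have "\<dots> \<le> Z"
      using D_mono_left[OF inext_curve_mono(1)[OF \<gamma> \<open>r \<in> I\<close> t1(1)], of "\<gamma> t0"] t1(3) r(3)
      by linarith
    finally show ?thesis by (simp add: r(1))
  qed
  then show "eventually (\<lambda>z. (tau l S \<circ> \<gamma> \<circ> real_of_ereal) z \<le> Z) (at_right (Inf (ereal ` I)))"
    unfolding eventually_at_right[OF less] using less by blast
qed

end

theorem proposition5p21:
  fixes l :: "'a::topological_space \<Rightarrow> 'a \<Rightarrow> ereal"
    and cv :: "'a curve_class"
    and S :: "'a set"
  assumes setting:
      "(lorentzian_pre_length_space l \<and> first_countable (euclidean :: 'a topology) \<and>
          cv = continuous_curve) \<or>
       (\<exists>\<rho>. KS_lorentzian_pre_length_space \<rho> l \<and> cv = lipschitz_curve \<rho> \<and>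
          metric_compatible cv \<rho> l)"
    and "causally_simple l"
    and "timelike_path_connected cv l"
    and "geodesic_space cv l"
    and "finite_lor_dist l"
    and "continuous_lor_dist l"
    and "compact_causal_diamonds l"
    and "no_bubbling_bdry l"
    and "condition_B cv l"
    and "chron_bdry l = {}"
    and "cauchy_set cv l S"
    and "continuous_on UNIV (dJ_pt l S)"
  shows "tau_well_defined l S \<and>
         continuous_on UNIV (tau l S) \<and>
         (\<forall>t. tau l S -` {t} = parallel_set l S t) \<and>
         (\<forall>I \<gamma>. inext_timelike_curve cv l I \<gamma> \<longrightarrow>
            filterlim (tau l S \<circ> \<gamma> \<circ> real_of_ereal) at_bot (at_right (Inf (ereal ` I))) \<and>
            filterlim (tau l S \<circ> \<gamma> \<circ> real_of_ereal) at_top (at_left (Sup (ereal ` I))))"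
proof -
  have "gluing_curve_class cv" and "lorentzian_pre_length_space l"
    using setting
  proof (atomize (full), elim disjE exE conjE, goal_cases)
    case 1
    then show ?case using gluing_continuous_curve by blast
  next
    case (2 \<rho>)
    \<comment> \<open>Equality of the topologies forces the carrier of the metric to be the whole
      type, as the triangle inequality in the Lipschitz gluing requires.\<close>
    then have "topspace (mtopology_of \<rho>) = UNIV"
      by (simp add: KS_lorentzian_pre_length_space_def)
    then show ?case
      using 2 gluing_lipschitz_curve[of \<rho>] by (simp add: KS_lorentzian_pre_length_space_def)
  qed
  then interpret complete_lorentzian_space cv l S
    using assms(2-)
    by (simp add: complete_lorentzian_space_def complete_lorentzian_space_axioms_def
        lorentzian_pre_length_space_def)
  show ?thesis
    using tau_well_defined continuous_tau tau_level_set tau_tendsto_past tau_tendsto_future by blast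
qed

end
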